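(* Let $w$ be the weight system on the lecture hall graph defined, for integers $t\ge 0$ and $0\le j\le i$, by \[ w(t;i,j)=\begin{cases}(aq^{j}+a^{-1}q^{-j})/2 & \text{if } t=0,\\ \widetilde w(t-1;i,j) & \text{if } t\ge 1,\end{cases} \] where, for $m\ge 0$, \[ \widetilde w(t;i,j)=\frac12 (abcd\,q^{2i})^m q^j\times\begin{cases} -a^{-1}q^{-i} & t=8m,\\ d & t=8m+1,\\ c & t=8m+2,\\ -acd\,q^{i} & t=8m+3,\\ b & t=8m+4,\\ -abd\,q^{i} & t=8m+5,\\ -abc\,q^{i} & t=8m+6,\\ a^2bcd\,q^{2i} & t=8m+7.\end{cases} \] Then the mixed moments $\sigma^{AW}_{n,k}(a,b,c,d;q)$ of the Askey--Wilson polynomials satisfy \[ \sigma^{AW}_{n,k}(a,b,c,d;q)=h^{w}_{n,k}\qquad (n\ge k\ge 0). \]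
   Context: Lecture hall graph. For integers $t\ge0$, $0\le j\le i$ put $v^t_{i,j}=(i,\,t+\frac{j}{i+1})$, and set $v^t_{i,i+1}:=v^{t+1}_{i,0}$. The vertices of the lecture hall graph are all $v^t_{i,j}$; its edges join $v^t_{i,j}$ with $v^t_{i,j+1}$ (vertical edges) and $v^t_{i,j}$ with $v^t_{i+1,j}$, for $t\ge 0$, $0\le j\le i$. An east step is a directed edge $(v^t_{i,j},v^t_{i+1,j})$; a south step is a vertical edge directed downwards, $(v^t_{i,j+1},v^t_{i,j})$. A weight system $w$ assigns a weight $w(t;i,j)$ to each east step $(v^t_{i,j},v^t_{i+1,j})$. The weight $w(p)$ of a path is the product of the weights of its east steps. $\mathrm{SE}((k,\infty)\to(n,0))$ is the set of paths $(\dots,v_2,v_1,v_0)$ with $v_0=(n,0)$, $\lim_{m\to\infty}v_m=(k,\infty)$, and each $(v_{m+1},v_m)$ a south or east step. Define $h^w_{n,k}=\sum_{p\in \mathrm{SE}((k,\infty)\to(n,0))}w(p)$ (so $h^w_{n,n}=1$). Askey--Wilson polynomials. The monic Askey--Wilson polynomials are \[ p_n(x;a,b,c,d|q)=\frac{(ab,ac,ad;q)_n}{2^na^n(abcdq^{n-1};q)_n}\;{}_4\phi_3\!\left(\begin{matrix}q^{-n},\,abcdq^{n-1},\,ae^{\mathbf i\theta},\,ae^{-\mathbf i\theta}\\ ab,\,ac,\,ad\end{matrix};q,q\right),\quad x=\cos\theta, \] with the standard notation $(z;q)_n=\prod_{i=0}^{n-1}(1-zq^i)$, $(z_1,\dots,z_r;q)_n=\prod_s(z_s;q)_n$,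 ${}_{4}\phi_3(\alpha_1,\dots,\alpha_4;\beta_1,\beta_2,\beta_3;q,z)=\sum_{k\ge0}\frac{(\alpha_1,\dots,\alpha_4;q)_k}{(q,\beta_1,\beta_2,\beta_3;q)_k}z^k$. The mixed moments are defined by $x^n=\sum_{k=0}^n\sigma^{AW}_{n,k}(a,b,c,d;q)\,p_k(x;a,b,c,d|q)$. Here $a,b,c,d,q$ are indeterminates, and the infinite sum $h^w_{n,k}$ is understood as the formal power series expansion, in $b,c,d$ with coefficients in $\mathbb{Q}(q)[a,a^{-1}]$. *)

theory Defs
  imports
    Complex_Main
    "HOL-Computational_Algebra.Computational_Algebra"
    "HOL-Library.Poly_Mapping"
    "HOL-Library.Groups_Big_Fun"
begin

section \<open>The coefficient field\<close>

text \<open>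
  The group algebra of the integers over \<open>\<rat>(q)\<close> is the ring \<open>\<rat>(q)[a, a\<^sup>-\<^sup>1]\<close> of Laurent
  polynomials; \<open>a\<^sup>e\<close> is \<open>Poly_Mapping.single e 1\<close>. The iterated power series ring
  \<open>\<rat>(q)[a, a\<^sup>-\<^sup>1][[b]][[c]][[d]]\<close> is \<open>\<rat>(q)[a, a\<^sup>-\<^sup>1][[b, c, d]]\<close>. It is an integral domain, and its
  field of fractions contains \<open>\<rat>(a, b, c, d, q)\<close>, so that rational functions of the
  indeterminates and power series can be compared in it.
\<close>

type_synonym ratq = "rat poly fract"
type_synonym laurent = "int \<Rightarrow>\<^sub>0 ratq"
type_synonym 'k pow3 = "'k fps fps fps"
type_synonym aw_field = "laurent pow3 fract"

definition scalar3 :: "'k::zero \<Rightarrow> 'k pow3" where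
  "scalar3 x = fps_const (fps_const (fps_const x))"

definition indet_q :: aw_field where
  "indet_q = to_fract (scalar3 (Poly_Mapping.single 0 (to_fract [:0, 1:])))"

definition indet_a :: aw_field where
  "indet_a = to_fract (scalar3 (Poly_Mapping.single 1 1))"

definition indet_b :: aw_field where
  "indet_b = to_fract (fps_const (fps_const fps_X))"

definition indet_c :: aw_field where
  "indet_c = to_fract (fps_const fps_X)"

definition indet_d :: aw_field where
  "indet_d = to_fract fps_X"


section \<open>Formal infinite sums\<close>

text \<open>The coefficient of \<open>b\<^sup>i c\<^sup>j d\<^sup>l\<close>.\<close>

definition coeff3 :: "'k pow3 \<Rightarrow> nat \<Rightarrow> nat \<Rightarrow> nat \<Rightarrow> 'k" where
  "coeff3 r i j l = fps_nth (fps_nth (fps_nth r l) j) i"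

text \<open>
  A family in the field of fractions has a formal sum if all its members are power series
  and each monomial occurs in only finitely many of them; the sum is then taken
  coefficientwise.
\<close>

definition has_formal_sum :: "('x \<Rightarrow> 'k::idom pow3 fract) \<Rightarrow> 'x set \<Rightarrow> 'k pow3 fract \<Rightarrow> bool" where
  "has_formal_sum f A s \<longleftrightarrow>
     (\<exists>g r. (\<forall>x\<in>A. f x = to_fract (g x)) \<and> s = to_fract r \<and>
        (\<forall>i j l. finite {x \<in> A. coeff3 (g x) i j l \<noteq> 0} \<and>
           coeff3 r i j l = (\<Sum>x | x \<in> A \<and> coeff3 (g x) i j l \<noteq> 0. coeff3 (g x) i j l)))"

definition formally_summable :: "('x \<Rightarrow> 'k::idom pow3 fract) \<Rightarrow> 'x set \<Rightarrow> bool" where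
  "formally_summable f A \<longleftrightarrow> (\<exists>s. has_formal_sum f A s)"

definition formal_sum :: "('x \<Rightarrow> 'k::idom pow3 fract) \<Rightarrow> 'x set \<Rightarrow> 'k pow3 fract" where
  "formal_sum f A = (THE s. has_formal_sum f A s)"

lemma has_formal_sum_unique:
  assumes "has_formal_sum f A s" and "has_formal_sum f A s'"
  shows "s = s'"
proof -
  obtain g r where g: "\<forall>x\<in>A. f x = to_fract (g x)" "s = to_fract r"
    "\<And>i j l. coeff3 r i j l = (\<Sum>x | x \<in> A \<and> coeff3 (g x) i j l \<noteq> 0. coeff3 (g x) i j l)"
    using assms(1) unfolding has_formal_sum_def by blast
  obtain g' r' where g': "\<forall>x\<in>A. f x = to_fract (g' x)" "s' = to_fract r'"
    "\<And>i j l. coeff3 r' i j l = (\<Sum>x | x \<in> A \<and> coeff3 (g' x) i j l \<noteq> 0. coeff3 (g' x) i j l)"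
    using assms(2) unfolding has_formal_sum_def by blast
  have "g x = g' x" if "x \<in> A" for x
    using g(1) g'(1) that by (metis to_fract_eq_iff)
  hence "coeff3 r i j l = coeff3 r' i j l" for i j l
    unfolding g(3) g'(3) by (intro sum.cong) auto
  hence "r = r'"
    by (simp add: coeff3_def fps_eq_iff)
  thus ?thesis using g(2) g'(2) by simp
qed

lemma formal_sum_eqI: "has_formal_sum f A s \<Longrightarrow> formal_sum f A = s"
  unfolding formal_sum_def by (blast intro: has_formal_sum_unique)


section \<open>The lecture hall graph\<close>

text \<open>
  The vertex \<open>v\<^sup>t\<^sub>i\<^sub>,\<^sub>j\<close>. The convention \<open>v\<^sup>t\<^sub>i\<^sub>,\<^sub>i\<^sub>+\<^sub>1 = v\<^sup>t\<^sup>+\<^sup>1\<^sub>i\<^sub>,\<^sub>0\<close> holds automatically, as both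
  sides have the same coordinates.
\<close>

definition lh_vertex :: "nat \<Rightarrow> nat \<Rightarrow> nat \<Rightarrow> nat \<times> real" where
  "lh_vertex t i j = (i, real t + real j / real (i + 1))"

lemma lh_vertex_Suc: "lh_vertex t i (i + 1) = lh_vertex (t + 1) i 0"
  by (simp add: lh_vertex_def field_simps)

definition east_step :: "nat \<times> real \<Rightarrow> nat \<times> real \<Rightarrow> bool" where
  "east_step u v \<longleftrightarrow> (\<exists>t i j. j \<le> i \<and> u = lh_vertex t i j \<and> v = lh_vertex t (i + 1) j)"

definition south_step :: "nat \<times> real \<Rightarrow> nat \<times> real \<Rightarrow> bool" where
  "south_step u v \<longleftrightarrow> (\<exists>t i j. j \<le> i \<and> u = lh_vertex t i (j + 1) \<and> v = lh_vertex t i j)"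

text \<open>
  A path \<open>(\<dots>, v\<^sub>2, v\<^sub>1, v\<^sub>0)\<close> is a sequence indexed from its end point, so its steps are
  directed from \<open>p (Suc m)\<close> to \<open>p m\<close>. Convergence to \<open>(k, \<infinity>)\<close> is componentwise.
\<close>

definition SE_paths :: "nat \<Rightarrow> nat \<Rightarrow> (nat \<Rightarrow> nat \<times> real) set" where
  "SE_paths k n = {p. p 0 = (n, 0) \<and>
     (\<lambda>m. fst (p m)) \<longlonglongrightarrow> k \<and> filterlim (\<lambda>m. snd (p m)) at_top sequentially \<and>
     (\<forall>m. south_step (p (Suc m)) (p m) \<or> east_step (p (Suc m)) (p m))}"

text \<open>
  An east step \<open>(v\<^sup>t\<^sub>i\<^sub>,\<^sub>j, v\<^sup>t\<^sub>i\<^sub>+\<^sub>1\<^sub>,\<^sub>j)\<close> with \<open>j \<le> i\<close> determines \<open>(t, i, j)\<close>, and a path uses each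
  edge at most once, so the product over east steps can be indexed by these triples.
\<close>

definition path_weight :: "(nat \<Rightarrow> nat \<Rightarrow> nat \<Rightarrow> 'f::comm_monoid_mult) \<Rightarrow> (nat \<Rightarrow> nat \<times> real) \<Rightarrow> 'f" where
  "path_weight w p =
     (\<Prod>(t, i, j) \<in> {(t, i, j). j \<le> i \<and>
        (\<exists>m. p (Suc m) = lh_vertex t i j \<and> p m = lh_vertex t (i + 1) j)}. w t i j)"

definition lh_h :: "(nat \<Rightarrow> nat \<Rightarrow> nat \<Rightarrow> 'k::idom pow3 fract) \<Rightarrow> nat \<Rightarrow> nat \<Rightarrow> 'k pow3 fract" where
  "lh_h w n k = formal_sum (path_weight w) (SE_paths k n)"


section \<open>Askey--Wilson polynomials\<close>

definition qpoch :: "'f::comm_ring_1 \<Rightarrow> 'f \<Rightarrow> nat \<Rightarrow> 'f" where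
  "qpoch z q n = (\<Prod>i<n. 1 - z * q ^ i)"

text \<open>
  The sum over all \<open>k\<close> is a sum over the nonzero terms, which is meaningful for terminating
  series.
\<close>

definition phi43 :: "'f::field \<Rightarrow> 'f \<Rightarrow> 'f \<Rightarrow> 'f \<Rightarrow> 'f \<Rightarrow> 'f \<Rightarrow> 'f \<Rightarrow> 'f \<Rightarrow> 'f \<Rightarrow> 'f" where
  "phi43 \<alpha>1 \<alpha>2 \<alpha>3 \<alpha>4 \<beta>1 \<beta>2 \<beta>3 q z =
     Sum_any (\<lambda>k. (qpoch \<alpha>1 q k * qpoch \<alpha>2 q k * qpoch \<alpha>3 q k * qpoch \<alpha>4 q k) /
                  (qpoch q q k * qpoch \<beta>1 q k * qpoch \<beta>2 q k * qpoch \<beta>3 q k) * z ^ k)"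

text \<open>The value at \<open>x = cos \<theta>\<close>, as a function of \<open>z = e\<^sup>i\<^sup>\<theta>\<close>.\<close>

definition aw_expr :: "nat \<Rightarrow> 'f::field \<Rightarrow> 'f \<Rightarrow> 'f \<Rightarrow> 'f \<Rightarrow> 'f \<Rightarrow> 'f \<Rightarrow> 'f" where
  "aw_expr n a b c d q z =
     (qpoch (a * b) q n * qpoch (a * c) q n * qpoch (a * d) q n) /
     (2 ^ n * a ^ n * qpoch (a * b * c * d * q powi (int n - 1)) q n) *
     phi43 (q powi (- int n)) (a * b * c * d * q powi (int n - 1)) (a * z) (a * inverse z)
           (a * b) (a * c) (a * d) q q"

text \<open>
  The polynomial in \<open>x = cos \<theta> = (z + z\<^sup>-\<^sup>1) / 2\<close> whose values are given by \<open>aw_expr\<close>. Over an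
  infinite field of characteristic other than two it exists and is unique, see below.
\<close>

definition aw_poly :: "nat \<Rightarrow> 'f::field \<Rightarrow> 'f \<Rightarrow> 'f \<Rightarrow> 'f \<Rightarrow> 'f \<Rightarrow> 'f poly" where
  "aw_poly n a b c d q =
     (THE P. \<forall>z. z \<noteq> 0 \<longrightarrow> poly P ((z + inverse z) / 2) = aw_expr n a b c d q z)"

lemma qpoch_pair:
  fixes a q z :: "'f::field"
  assumes "(2::'f) \<noteq> 0" and "z \<noteq> 0"
  shows "qpoch (a * z) q k * qpoch (a * inverse z) q k =
    poly (\<Prod>i<k. [:1 + a\<^sup>2 * q ^ (2 * i), - 2 * a * q ^ i:]) ((z + inverse z) / 2)"
  unfolding qpoch_def poly_prod prod.distrib[symmetric]
proof (rule prod.cong[OF refl])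
  fix i
  have "(1 - a * z * q ^ i) * (1 - a * inverse z * q ^ i) =
    1 + a\<^sup>2 * q ^ (2 * i) * (z * inverse z) - a * q ^ i * (z + inverse z)"
    by (simp add: algebra_simps power2_eq_square power_mult)
  also have "\<dots> = poly [:1 + a\<^sup>2 * q ^ (2 * i), - 2 * a * q ^ i:] ((z + inverse z) / 2)"
    using assms by (simp add: field_simps)
  finally show "(1 - a * z * q ^ i) * (1 - a * inverse z * q ^ i) = \<dots>" .
qed

lemma qpoch_neg_power_eq_0:
  fixes q :: "'f::field"
  assumes "q \<noteq> 0" and "n < k"
  shows "qpoch (q powi (- int n)) q k = 0"
proof -
  have "1 - q powi (- int n) * q ^ n = 0"
    using assms(1) by (simp add: power_int_minus)
  thus ?thesis unfolding qpoch_def using assms(2) by (intro prod_zero) auto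
qed

lemma aw_poly_exists:
  fixes q :: "'f::field"
  assumes "(2::'f) \<noteq> 0" and "q \<noteq> 0"
  shows "\<exists>P. \<forall>z. z \<noteq> 0 \<longrightarrow> poly P ((z + inverse z) / 2) = aw_expr n a b c d q z"
proof -
  define C where "C = (qpoch (a * b) q n * qpoch (a * c) q n * qpoch (a * d) q n) /
     (2 ^ n * a ^ n * qpoch (a * b * c * d * q powi (int n - 1)) q n)"
  define e where "e k = qpoch (q powi (- int n)) q k * qpoch (a * b * c * d * q powi (int n - 1)) q k /
    (qpoch q q k * qpoch (a * b) q k * qpoch (a * c) q k * qpoch (a * d) q k) * q ^ k" for k
  define P where "P = (\<Sum>k\<le>n. smult (C * e k)
    (\<Prod>i<k. [:1 + a\<^sup>2 * q ^ (2 * i), - 2 * a * q ^ i:]))"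
  have "poly P ((z + inverse z) / 2) = aw_expr n a b c d q z" if "z \<noteq> 0" for z
  proof -
    define f where "f k = e k * (qpoch (a * z) q k * qpoch (a * inverse z) q k)" for k
    have "aw_expr n a b c d q z = C * Sum_any f"
    proof -
      have "f = (\<lambda>k. (qpoch (q powi (- int n)) q k * qpoch (a * b * c * d * q powi (int n - 1)) q k *
          qpoch (a * z) q k * qpoch (a * inverse z) q k) /
          (qpoch q q k * qpoch (a * b) q k * qpoch (a * c) q k * qpoch (a * d) q k) * q ^ k)"
        by (rule ext) (simp only: f_def e_def times_divide_eq_left times_divide_eq_right mult_ac)
      thus ?thesis
        by (simp only: aw_expr_def phi43_def C_def)
    qed
    also have "Sum_any f = (\<Sum>k\<le>n. f k)"
    proof (rule Sum_any.expand_superset)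
      show "{k. f k \<noteq> 0} \<subseteq> {..n}"
      proof
        fix k assume "k \<in> {k. f k \<noteq> 0}"
        hence "qpoch (q powi (- int n)) q k \<noteq> 0"
          unfolding f_def e_def by (metis (mono_tags, lifting) div_0 mem_Collect_eq mult_zero_left)
        thus "k \<in> {..n}" using qpoch_neg_power_eq_0[OF assms(2), of n k] by (meson atMost_iff not_le)
      qed
    qed simp
    also have "C * \<dots> = poly P ((z + inverse z) / 2)"
      unfolding P_def poly_sum poly_smult sum_distrib_left f_def
        qpoch_pair[OF assms(1) that] mult.assoc ..
    finally show ?thesis by simp
  qed
  thus ?thesis by blast
qed

lemma aw_poly_unique:
  fixes P Q :: "'f::field poly"
  assumes "(2::'f) \<noteq> 0" and "infinite (UNIV :: 'f set)"
    and "\<And>z. z \<noteq> 0 \<Longrightarrow> poly P ((z + inverse z) / 2) = poly Q ((z + inverse z) / 2)"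
  shows "P = Q"
proof (rule ccontr)
  assume "P \<noteq> Q"
  hence fin: "finite {x. poly (P - Q) x = 0}"
    by (intro poly_roots_finite) simp
  have fin2: "finite {z. z \<noteq> 0 \<and> (z + inverse z) / 2 = x}" for x :: 'f
  proof (rule finite_subset)
    show "{z. z \<noteq> 0 \<and> (z + inverse z) / 2 = x} \<subseteq> {z. poly [:1, - 2 * x, 1:] z = 0}"
      using assms(1) by (auto simp: field_simps)
    show "finite {z. poly [:1, - 2 * x, 1:] z = 0}"
      by (rule poly_roots_finite) simp
  qed
  have "(z + inverse z) / 2 \<in> {x. poly (P - Q) x = 0}" if "z \<noteq> 0" for z
    using assms(3)[OF that] by simp
  hence "UNIV - {0} \<subseteq> (\<Union>x\<in>{x. poly (P - Q) x = 0}. {z. z \<noteq> 0 \<and> (z + inverse z) / 2 = x})"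
    unfolding subset_iff UN_iff by blast
  hence "finite (UNIV - {0 :: 'f})"
    by (rule finite_subset) (intro finite_UN_I fin fin2)
  thus False using assms(2) by simp
qed

lemma poly_aw_poly:
  fixes q :: "'f::field"
  assumes "(2::'f) \<noteq> 0" and "infinite (UNIV :: 'f set)" and "q \<noteq> 0" and "z \<noteq> 0"
  shows "poly (aw_poly n a b c d q) ((z + inverse z) / 2) = aw_expr n a b c d q z"
proof -
  have "\<exists>!P. \<forall>z. z \<noteq> 0 \<longrightarrow> poly P ((z + inverse z) / 2) = aw_expr n a b c d q z"
    using aw_poly_exists[OF assms(1,3)] aw_poly_unique[OF assms(1,2)]
    by (intro ex_ex1I) auto
  from theI'[OF this] show ?thesis
    using assms(4) unfolding aw_poly_def by blast
qed

text \<open>The coefficients of \<open>x\<^sup>n\<close> with respect to a sequence of polynomials with \<open>degree (P k) = k\<close>.\<close>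

definition mixed_moment :: "(nat \<Rightarrow> 'f::field poly) \<Rightarrow> nat \<Rightarrow> nat \<Rightarrow> 'f" where
  "mixed_moment P n =
     (THE s. (\<forall>k>n. s k = 0) \<and> monom 1 n = (\<Sum>k\<le>n. smult (s k) (P k)))"

definition aw_mixed_moment :: "'f::field \<Rightarrow> 'f \<Rightarrow> 'f \<Rightarrow> 'f \<Rightarrow> 'f \<Rightarrow> nat \<Rightarrow> nat \<Rightarrow> 'f" where
  "aw_mixed_moment a b c d q n k = mixed_moment (\<lambda>m. aw_poly m a b c d q) n k"


section \<open>The weight system\<close>

definition aw_weight_tail :: "'f::field \<Rightarrow> 'f \<Rightarrow> 'f \<Rightarrow> 'f \<Rightarrow> 'f \<Rightarrow> nat \<Rightarrow> nat \<Rightarrow> nat \<Rightarrow> 'f" where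
  "aw_weight_tail a b c d q t i j =
     1 / 2 * (a * b * c * d * q ^ (2 * i)) ^ (t div 8) * q ^ j *
     ([- (inverse a * inverse (q ^ i)),
       d,
       c,
       - (a * c * d * q ^ i),
       b,
       - (a * b * d * q ^ i),
       - (a * b * c * q ^ i),
       a\<^sup>2 * b * c * d * q ^ (2 * i)] ! (t mod 8))"

definition aw_weight :: "'f::field \<Rightarrow> 'f \<Rightarrow> 'f \<Rightarrow> 'f \<Rightarrow> 'f \<Rightarrow> nat \<Rightarrow> nat \<Rightarrow> nat \<Rightarrow> 'f" where
  "aw_weight a b c d q t i j =
     (if t = 0 then (a * q ^ j + inverse a * inverse (q ^ j)) / 2
      else aw_weight_tail a b c d q (t - 1) i j)"

end

(*
  The polynomials N_m(x) = prod_{l<m} (x - (a q^l + a^-1 q^-l)/2) are multiples of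
  (az, a/z; q)_m, and Newton interpolation at these nodes expresses x^n in terms of them; the
  coefficients are complete homogeneous symmetric polynomials, which are generated by the layer
  t = 0 of the graph. So it remains to expand N_n in Askey-Wilson polynomials, with coefficient
  matrix F, by means of the layers t >= 1.

  The part of a path inside the layer t >= 1 contributes a Gaussian binomial coefficient times a
  product over columns, that is, the matrix of the layer is the matrix of Gaussian binomials
  scaled by column weights. By the q-binomial theorem two such matrices whose scalings differ by
  the factor -x q^i multiply to one scaled by 1 - x q^i. The eight layers of a period therefore
  collapse to a single matrix E, scaled by (1 - ab q^i)(1 - ac q^i)(1 - ad q^i) up to the factor
  -a^-1 q^-i / 2, and the next period is the same matrix scaled by Y q^{2i}, where Y = abcd. The
  matrix F, obtained by inverting the coefficients of the 4phi3 series, satisfies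
  F = E * (F scaled by Y q^{2i}). After M periods the mixed moment hence differs from the sum over
  the paths that start below height 8 M + 1 by a multiple of Y^M, and M tends to infinity d-adically.
*)
theory Submission
  imports Defs "HOL-Library.FuncSet"
begin

section \<open>Gaussian binomial coefficients\<close>


definition mat_mult :: "(nat \<Rightarrow> nat \<Rightarrow> 'f::comm_ring_1) \<Rightarrow> (nat \<Rightarrow> nat \<Rightarrow> 'f) \<Rightarrow> nat \<Rightarrow> nat \<Rightarrow> 'f" where
  "mat_mult X Y n k = (\<Sum>m=k..n. X n m * Y m k)"

text \<open>On the triangle \<open>k \<le> n\<close> this is conjugation by the diagonal matrix with
  entries \<open>\<Prod>i<n. v i\<close>, written without division so that \<open>v i\<close> may
  vanish.\<close>

definition mat_scale :: "(nat \<Rightarrow> 'f::comm_ring_1) \<Rightarrow> (nat \<Rightarrow> nat \<Rightarrow> 'f) \<Rightarrow> nat \<Rightarrow> nat \<Rightarrow> 'f" where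
  "mat_scale v X n k = X n k * (\<Prod>i=k..<n. v i)"

lemma mat_mult_assoc: "mat_mult (mat_mult X Y) Z = mat_mult X (mat_mult Y Z)"
proof (intro ext)
  fix n k
  have "(\<Sum>m=k..n. \<Sum>l=m..n. X n l * Y l m * Z m k) = (\<Sum>l=k..n. \<Sum>m=k..l. X n l * Y l m * Z m k)"
    unfolding sum.Sigma[OF finite_atLeastAtMost ballI[OF finite_atLeastAtMost]]
    by (rule sum.reindex_bij_witness[of _ "\<lambda>(x, y). (y, x)" "\<lambda>(x, y). (y, x)"]) auto
  thus "mat_mult (mat_mult X Y) Z n k = mat_mult X (mat_mult Y Z) n k"
    by (simp add: mat_mult_def sum_distrib_left sum_distrib_right mult.assoc)
qed

text \<open>The product over \<open>{k..<n}\<close> splits at every intermediate index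
  \<open>m\<close>, so all summands of the matrix product pick up the same factor.\<close>

lemma mat_scale_mult: "mat_scale v (mat_mult X Y) = mat_mult (mat_scale v X) (mat_scale v Y)"
proof (intro ext)
  fix n k
  have "(\<Prod>i=k..<n. v i) = (\<Prod>i=k..<m. v i) * (\<Prod>i=m..<n. v i)" if "m \<in> {k..n}" for m
    using that by (simp add: prod.atLeastLessThan_concat)
  thus "mat_scale v (mat_mult X Y) n k = mat_mult (mat_scale v X) (mat_scale v Y) n k"
    unfolding mat_mult_def mat_scale_def sum_distrib_right
    by (intro sum.cong refl) (simp add: mult_ac)
qed

lemma mat_scale_scale: "mat_scale v (mat_scale v' X) = mat_scale (\<lambda>i. v i * v' i) X"
  by (intro ext) (simp add: mat_scale_def prod.distrib mult_ac)

section \<open>q-shifted factorials and identities for Gaussian binomials\<close>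

lemma qpoch_0 [simp]: "qpoch z q 0 = 1"
  by (simp add: qpoch_def)

lemma qpoch_Suc: "qpoch z q (Suc n) = qpoch z q n * (1 - z * q ^ n)"
  by (simp add: qpoch_def)

lemma qpoch_add: "qpoch z q (m + n) = qpoch z q m * qpoch (z * q ^ m) q n"
  by (induction n) (simp_all add: qpoch_Suc power_add mult_ac)

lemma qpoch_Suc_left: "qpoch z q (Suc n) = (1 - z) * qpoch (z * q) q n"
  using qpoch_add[of z q 1 n] by (simp add: qpoch_Suc)

lemma qpoch_shift: "qpoch (z * q ^ k) q n = (\<Prod>i=k..<k+n. 1 - z * q ^ i)"
  by (induction n) (simp_all add: qpoch_Suc power_add mult_ac)

lemma qpoch_nonzero: "(\<And>i. i < n \<Longrightarrow> z * q ^ i \<noteq> 1) \<Longrightarrow> qpoch (z :: 'f :: field) q n \<noteq> 0"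
  by (auto simp: qpoch_def)

definition qbin :: "'f::field \<Rightarrow> nat \<Rightarrow> nat \<Rightarrow> 'f" where
  "qbin q n k = (if k \<le> n then qpoch q q n / (qpoch q q k * qpoch q q (n - k)) else 0)"

locale non_root =
  fixes q :: "'f::field"
  assumes q_nonzero: "q \<noteq> 0" and pow_q_neq_1: "0 < n \<Longrightarrow> q ^ n \<noteq> 1"
begin

lemma qpoch_q_nonzero [simp]: "qpoch q q n \<noteq> 0"
  using pow_q_neq_1 by (intro qpoch_nonzero) (metis power_Suc zero_less_Suc)

lemma qbin_0 [simp]: "qbin q n 0 = 1" and qbin_self [simp]: "qbin q n n = 1"
  by (simp_all add: qbin_def)

lemma qbin_eq_0 [simp]: "n < k \<Longrightarrow> qbin q n k = 0"
  by (simp add: qbin_def)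

lemma qbin_Pascal: "qbin q (Suc n) (Suc k) = qbin q n (Suc k) + q ^ (n - k) * qbin q n k"
proof (cases "k < n")
  case True
  define l where "l = n - Suc k"
  have n: "n = Suc k + l" using True by (simp add: l_def)
  have nz: "1 - q * q ^ l \<noteq> 0" "1 - q * q ^ k \<noteq> 0"
    using pow_q_neq_1[of "Suc l"] pow_q_neq_1[of "Suc k"] by auto
  have d: "Suc n - Suc k = Suc l" "n - Suc k = l" "n - k = Suc l" using n by auto
  have e: "q * q ^ n = q * (q * (q ^ k * q ^ l))" by (simp add: n power_add)
  show ?thesis
    using nz qpoch_q_nonzero[of k] qpoch_q_nonzero[of l] True unfolding qbin_def d
    by (simp add: qpoch_Suc e divide_simps) (simp add: algebra_simps)
qed (auto simp: qbin_def not_less le_less)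

lemma qbin_Pascal': "qbin q (Suc n) (Suc k) = q ^ Suc k * qbin q n (Suc k) + qbin q n k"
proof (cases "k < n")
  case True
  define l where "l = n - Suc k"
  have n: "n = Suc k + l" using True by (simp add: l_def)
  have nz: "1 - q * q ^ l \<noteq> 0" "1 - q * q ^ k \<noteq> 0"
    using pow_q_neq_1[of "Suc l"] pow_q_neq_1[of "Suc k"] by auto
  have d: "Suc n - Suc k = Suc l" "n - Suc k = l" "n - k = Suc l" using n by auto
  have e: "q * q ^ n = q * (q * (q ^ k * q ^ l))" by (simp add: n power_add)
  show ?thesis
    using nz qpoch_q_nonzero[of k] qpoch_q_nonzero[of l] True unfolding qbin_def d
    by (simp add: qpoch_Suc e divide_simps) (simp add: algebra_simps)
qed (auto simp: qbin_def not_less le_less)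

lemma qbin_mult:
  "k \<le> m \<Longrightarrow> m \<le> n \<Longrightarrow> qbin q n m * qbin q m k = qbin q n k * qbin q (n - k) (m - k)"
  by (simp add: qbin_def field_simps)

text \<open>Pascal's rule as a summation rule: it moves the step in \<open>n\<close> from the
  binomial to the summand and drives the next two inductions.\<close>

lemma sum_qbin_Suc:
  "(\<Sum>j\<le>Suc n. qbin q (Suc n) j * g j) = (\<Sum>j\<le>n. qbin q n j * (g j + q ^ (n - j) * g (Suc j)))"
proof -
  have "(\<Sum>j\<le>Suc n. qbin q (Suc n) j * g j) =
      g 0 + (\<Sum>j\<le>n. qbin q n (Suc j) * g (Suc j)) + (\<Sum>j\<le>n. qbin q n j * (q ^ (n - j) * g (Suc j)))"
    by (simp add: sum.atMost_Suc_shift qbin_Pascal algebra_simps sum.distrib del: sum.atMost_Suc)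
  also have "g 0 + (\<Sum>j\<le>n. qbin q n (Suc j) * g (Suc j)) = (\<Sum>j\<le>Suc n. qbin q n j * g j)"
    by (subst sum.atMost_Suc_shift) simp
  also have "\<dots> = (\<Sum>j\<le>n. qbin q n j * g j)"
    by simp
  finally show ?thesis
    by (simp add: algebra_simps sum.distrib)
qed

lemma q_binomial: "(\<Sum>j\<le>n. qbin q n j * (\<Prod>i<j. - x * q ^ i)) = qpoch x q n"
proof (induction n)
  case (Suc n)
  \<comment> \<open>The bracket of \<open>sum_qbin_Suc\<close> is the old summand times a factor
    free of \<open>j\<close>, which leaves the sum.\<close>
  have "(\<Prod>i<j. - x * q ^ i) + q ^ (n - j) * (\<Prod>i<Suc j. - x * q ^ i) =
      (\<Prod>i<j. - x * q ^ i) * (1 - x * q ^ n)" if "j \<le> n" for j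
  proof -
    have "q ^ n = q ^ (n - j) * q ^ j" using that by (simp flip: power_add)
    thus ?thesis by (simp add: algebra_simps)
  qed
  hence "(\<Sum>j\<le>Suc n. qbin q (Suc n) j * (\<Prod>i<j. - x * q ^ i)) =
      (\<Sum>j\<le>n. qbin q n j * (\<Prod>i<j. - x * q ^ i)) * (1 - x * q ^ n)"
    unfolding sum_qbin_Suc sum_distrib_right by (intro sum.cong) (auto simp: mult.assoc)
  thus ?case unfolding Suc qpoch_Suc .
qed simp

text \<open>A finite form of Cauchy's identity. Induction with \<open>y\<close> free: the sum for
  \<open>Suc n\<close> is \<open>1 - y * q ^ n\<close> times the sum for \<open>y\<close> plus
  \<open>y * q ^ n\<close> times the sum for \<open>y * q\<close>, and both sums are 1.\<close>

lemma q_Cauchy: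
  "(\<Sum>j\<le>n. qbin q n j * ((\<Prod>i<j. y * q ^ (2 * i)) * qpoch (y * q ^ j) q (n - j))) = 1"
proof (induction n arbitrary: y)
  case (Suc n)
  have aux: "(\<Prod>i<j. y * q ^ (2 * i)) * qpoch (y * q ^ j) q (Suc n - j) +
        q ^ (n - j) * ((\<Prod>i<Suc j. y * q ^ (2 * i)) * qpoch (y * q ^ Suc j) q (Suc n - Suc j)) =
      (\<Prod>i<j. y * q ^ (2 * i)) * qpoch (y * q ^ j) q (n - j) * (1 - y * q ^ n) +
      y * q ^ n * ((\<Prod>i<j. (y * q) * q ^ (2 * i)) * qpoch ((y * q) * q ^ j) q (n - j))"
    if "j \<le> n" for j
  proof -
    define l where "l = n - j"
    have n: "n = j + l" using that by (simp add: l_def)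
    have d: "Suc n - j = Suc l" "n - j = l" using n by auto
    have "(\<Prod>i<j. (y * q) * q ^ (2 * i)) = q ^ j * (\<Prod>i<j. y * q ^ (2 * i))"
      by (simp add: prod.distrib mult_ac)
    thus ?thesis
      by (simp add: d qpoch_Suc) (simp add: n power_add mult_2 mult_2_right algebra_simps)
  qed
  have "(\<Sum>j\<le>Suc n. qbin q (Suc n) j * ((\<Prod>i<j. y * q ^ (2 * i)) * qpoch (y * q ^ j) q (Suc n - j))) =
      (\<Sum>j\<le>n. qbin q n j * ((\<Prod>i<j. y * q ^ (2 * i)) * qpoch (y * q ^ j) q (n - j))) * (1 - y * q ^ n) +
      y * q ^ n * (\<Sum>j\<le>n. qbin q n j *
        ((\<Prod>i<j. (y * q) * q ^ (2 * i)) * qpoch ((y * q) * q ^ j) q (n - j)))"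
    unfolding sum_qbin_Suc sum_distrib_right sum_distrib_left sum.distrib[symmetric]
    by (intro sum.cong refl, subst aux) (auto simp: algebra_simps)
  thus ?case unfolding Suc by simp
qed simp

text \<open>By \<open>qbin_mult\<close> the factor \<open>qbin q n k\<close> leaves the sum;
  substituting \<open>m = k + j\<close> gives the shape of \<open>q_binomial\<close> and
  \<open>q_Cauchy\<close>.\<close>

lemma sum_qbin_shift:
  fixes g :: "nat \<Rightarrow> 'f"
  assumes "k \<le> n"
  shows "(\<Sum>m=k..n. qbin q n m * qbin q m k * g m) = qbin q n k * (\<Sum>j\<le>n-k. qbin q (n - k) j * g (k + j))"
proof -
  have "(\<Sum>m=k..n. qbin q n m * qbin q m k * g m) = (\<Sum>m=k..n. qbin q n k * (qbin q (n - k) (m - k) * g m))"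
    by (intro sum.cong) (auto simp: qbin_mult mult.assoc)
  also have "\<dots> = (\<Sum>j\<le>n-k. qbin q n k * (qbin q (n - k) j * g (k + j)))"
    by (rule sum.reindex_bij_witness[of _ "\<lambda>j. k + j" "\<lambda>m. m - k"]) (use assms in auto)
  finally show ?thesis by (simp add: sum_distrib_left)
qed

lemma prod_shift:
  fixes g :: "nat \<Rightarrow> 'f"
  shows "(\<Prod>i=k..<k+j. g i) = (\<Prod>i<j. g (k + i))"
  using prod.shift_bounds_nat_ivl[of g 0 k j] by (simp add: lessThan_atLeast0 add.commute)

text \<open>The q-binomial theorem in matrix form. It is the mechanism that merges two layers of the
  graph into one.\<close>

lemma mat_scale_qbin_mult:
  "mat_mult (mat_scale \<rho> (qbin q)) (mat_scale (\<lambda>i. - x * q ^ i * \<rho> i) (qbin q)) =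
    mat_scale (\<lambda>i. (1 - x * q ^ i) * \<rho> i) (qbin q)"
proof -
  \<comment> \<open>Without the common weights, the entry \<open>(n, k)\<close> is
    \<open>q_binomial\<close> at \<open>x * q ^ k\<close>. The weights \<open>\<rho>\<close> are
    restored at the end, because scaling is multiplicative.\<close>
  have *: "mat_mult (qbin q) (mat_scale (\<lambda>i. - x * q ^ i) (qbin q)) n k =
      mat_scale (\<lambda>i. 1 - x * q ^ i) (qbin q) n k" for n k
  proof (cases "k \<le> n")
    case True
    have "(\<Prod>i=k..<k+j. - x * q ^ i) = (\<Prod>i<j. - (x * q ^ k) * q ^ i)" for j
      by (simp add: prod_shift power_add mult_ac)
    moreover have "qpoch (x * q ^ k) q (n - k) = (\<Prod>i=k..<n. 1 - x * q ^ i)"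
      using True by (simp add: qpoch_shift)
    ultimately show ?thesis
      using sum_qbin_shift[OF True, of "\<lambda>m. \<Prod>i=k..<m. - x * q ^ i"]
        q_binomial[of "n - k" "x * q ^ k"]
      by (simp add: mat_mult_def mat_scale_def mult.assoc)
  qed (simp add: mat_mult_def mat_scale_def)
  hence "mat_mult (qbin q) (mat_scale (\<lambda>i. - x * q ^ i) (qbin q)) =
      mat_scale (\<lambda>i. 1 - x * q ^ i) (qbin q)" by blast
  hence "mat_scale \<rho> (mat_mult (qbin q) (mat_scale (\<lambda>i. - x * q ^ i) (qbin q))) =
      mat_scale \<rho> (mat_scale (\<lambda>i. 1 - x * q ^ i) (qbin q))" by simp
  thus ?thesis
    by (simp add: mat_scale_mult mat_scale_scale mult_ac)
qed

end

section \<open>The connection matrix, its recursion and the sum that inverts it\<close>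

locale generic_Y = non_root q for q :: "'f::field" +
  fixes Y :: 'f
  assumes Y_generic: "Y * q ^ n \<noteq> 1"
begin

lemma qpoch_Y_nonzero [simp]: "qpoch (Y * q ^ m) q n \<noteq> 0"
  using Y_generic by (intro qpoch_nonzero) (metis mult.assoc power_add)

text \<open>With \<open>Y = abcd\<close> and suitable weights this matrix expands the Newton
  polynomials in Askey-Wilson polynomials.\<close>

definition conn :: "(nat \<Rightarrow> 'f) \<Rightarrow> nat \<Rightarrow> nat \<Rightarrow> 'f" where
  "conn \<rho> n k = mat_scale \<rho> (qbin q) n k / qpoch (Y * q ^ (2 * k)) q (n - k)"

text \<open>The weights \<open>\<rho>\<close> factor out of every summand; what remains is
  \<open>q_Cauchy\<close> at \<open>y = Y * q ^ (2 * k)\<close>, divided by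
  \<open>qpoch y q (n - k)\<close>. Iterating this equation produces one period of layers after
  another.\<close>

lemma conn_rec:
  assumes "k \<le> n"
  shows "mat_mult (mat_scale \<rho> (qbin q)) (mat_scale (\<lambda>i. Y * q ^ (2 * i)) (conn \<rho>)) n k = conn \<rho> n k"
proof -
  define y where "y = Y * q ^ (2 * k)"
  have y: "qpoch y q j \<noteq> 0" for j by (simp add: y_def)
  define g where "g m = (\<Prod>i=k..<m. Y * q ^ (2 * i)) / qpoch y q (m - k)" for m
  have "qbin q (n - k) j * ((\<Prod>i<j. y * q ^ (2 * i)) * qpoch (y * q ^ j) q (n - k - j)) =
      qbin q (n - k) j * g (k + j) * qpoch y q (n - k)" if "j \<le> n - k" for j
  proof -
    have "qpoch y q (n - k) = qpoch y q j * qpoch (y * q ^ j) q (n - k - j)"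
      using qpoch_add[of y q j "n - k - j"] that by (simp del: diff_diff_left)
    moreover have "(\<Prod>i=k..<k+j. Y * q ^ (2 * i)) = (\<Prod>i<j. y * q ^ (2 * i))"
      by (simp add: prod_shift y_def power_add mult_ac)
    ultimately show ?thesis using y[of j] by (simp add: g_def)
  qed
  note * = this[symmetric]
  have "(\<Sum>j\<le>n-k. qbin q (n - k) j * g (k + j)) * qpoch y q (n - k) = 1"
    unfolding sum_distrib_right q_Cauchy[of "n - k" y, symmetric] by (intro sum.cong refl *) simp
  hence *: "(\<Sum>m=k..n. qbin q n m * qbin q m k * g m) = qbin q n k / qpoch y q (n - k)"
    unfolding sum_qbin_shift[OF assms] using y[of "n - k"] by (simp add: field_simps)
  have "(\<Prod>i=k..<n. \<rho> i) = (\<Prod>i=m..<n. \<rho> i) * (\<Prod>i=k..<m. \<rho> i)" if "m \<in> {k..n}" for m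
    using that by (subst mult.commute) (simp add: prod.atLeastLessThan_concat)
  hence "mat_mult (mat_scale \<rho> (qbin q)) (mat_scale (\<lambda>i. Y * q ^ (2 * i)) (conn \<rho>)) n k =
      (\<Sum>m=k..n. qbin q n m * qbin q m k * g m) * (\<Prod>i=k..<n. \<rho> i)"
    unfolding mat_mult_def mat_scale_def conn_def sum_distrib_right
    by (intro sum.cong refl) (simp add: g_def y_def mult_ac)
  thus ?thesis
    by (simp add: * conn_def mat_scale_def y_def)
qed

lemma prod_neg_power_Suc: "(\<Prod>i<Suc j. - (q ^ i)) = - (\<Prod>i<j. - (q ^ Suc i))"
  by (simp only: prod.lessThan_Suc_shift) simp

text \<open>The sum telescopes: this is its partial sum.\<close>

lemma inversion_partial_sum:
  assumes "J \<le> N"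
  shows "(\<Sum>j\<le>J. qbin q (Suc N) j * (\<Prod>i<j. - (q ^ i)) /
      (qpoch (Y * q ^ (m + 2 * j)) q (Suc N - j) * qpoch (Y * q ^ (m + j - 1)) q j)) =
    (\<Prod>i<J. - (q ^ Suc i)) * qbin q N J / qpoch (Y * q ^ (m + J)) q (Suc N)"
  using assms
proof (induction J)
  case (Suc J)
  define l where "l = N - Suc J"
  have N: "N = J + Suc l" using Suc.prems by (simp add: l_def)
  define y where "y = Y * q ^ (m + J)"
  define P where "P = qpoch (y * q) q J"
  define Q where "Q = qpoch (y * q ^ (J + 2)) q l"
  define S where "S = (\<Prod>i<J. - (q ^ Suc i))"
  \<comment> \<open>The common factor of the three binomials in the induction step.\<close>
  define D where "D = qpoch q q N / (qpoch q q (Suc J) * qpoch q q (Suc l))"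
  have Y_pow: "Y * q ^ (m + J + i) = y * q ^ i" for i
    by (simp add: y_def power_add mult_ac)
  have y: "1 - y * q ^ i \<noteq> 0" for i
    using Y_generic[of "m + J + i"] unfolding Y_pow by simp
  have nz: "P \<noteq> 0" "Q \<noteq> 0"
    using qpoch_Y_nonzero[of "m + J + 1" J] qpoch_Y_nonzero[of "m + J + (J + 2)" l]
    unfolding Y_pow P_def Q_def by simp_all
  have qnz: "1 - q ^ Suc i \<noteq> 0" for i
    using pow_q_neq_1[of "Suc i"] by simp
  have bins: "qbin q N J = (1 - q ^ Suc J) * D" "qbin q N (Suc J) = (1 - q ^ Suc l) * D"
    "qbin q (Suc N) (Suc J) = (1 - q ^ (J + l + 2)) * D"
    using qnz[of J] qnz[of l] by (simp_all add: qbin_def D_def N qpoch_Suc)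
  have poch: "qpoch y q (Suc N) = (1 - y) * P * (1 - y * q ^ Suc J) * Q"
    "qpoch (y * q) q (Suc N) = P * (1 - y * q ^ Suc J) * Q * (1 - y * q ^ (J + l + 2))"
    "qpoch (y * q ^ (J + 2)) q (Suc l) = Q * (1 - y * q ^ (J + l + 2))"
    "qpoch y q (Suc J) = (1 - y) * P"
  proof -
    have *: "qpoch (y * q) q (J + Suc i) = P * (1 - y * q ^ Suc J) * qpoch (y * q ^ (J + 2)) q i" for i
      unfolding qpoch_add qpoch_Suc_left P_def by (simp add: mult_ac)
    show 1: "qpoch (y * q ^ (J + 2)) q (Suc l) = Q * (1 - y * q ^ (J + l + 2))"
      by (simp add: Q_def qpoch_Suc power_add mult_ac)
    show "qpoch y q (Suc N) = (1 - y) * P * (1 - y * q ^ Suc J) * Q"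
      unfolding qpoch_Suc_left[of y] N * by (simp add: Q_def mult_ac)
    show "qpoch (y * q) q (Suc N) = P * (1 - y * q ^ Suc J) * Q * (1 - y * q ^ (J + l + 2))"
      using *[of "Suc l"] 1 by (simp add: N mult_ac)
    show "qpoch y q (Suc J) = (1 - y) * P"
      by (simp add: qpoch_Suc_left P_def)
  qed
  have signs: "(\<Prod>i<Suc J. - (q ^ i)) = - S" "(\<Prod>i<Suc J. - (q ^ Suc i)) = - (S * q ^ Suc J)"
    by (simp_all only: S_def prod_neg_power_Suc) simp
  have idx: "m + 2 * Suc J = m + J + (J + 2)" "m + Suc J - 1 = m + J" "m + Suc J = m + J + 1"
    "Suc N - Suc J = Suc l"
    by (simp_all add: N)
  \<comment> \<open>The difference of consecutive closed forms is the new summand. In terms of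
    \<open>r = q ^ Suc J\<close> and \<open>s = q ^ Suc l\<close> this is a rational identity in
    \<open>y\<close>, \<open>r\<close> and \<open>s\<close>.\<close>
  have "S * ((1 - q ^ Suc J) * D) / ((1 - y) * P * (1 - y * q ^ Suc J) * Q) +
      (1 - q ^ (J + l + 2)) * D * (- S) / (Q * (1 - y * q ^ (J + l + 2)) * ((1 - y) * P)) =
      - (S * q ^ Suc J) * ((1 - q ^ Suc l) * D) / (P * (1 - y * q ^ Suc J) * Q * (1 - y * q ^ (J + l + 2)))"
  proof -
    define r s where "r = q ^ Suc J" and "s = q ^ Suc l"
    have rs: "q ^ (J + l + 2) = r * s" by (simp add: r_def s_def power_add mult_ac)
    have "1 - y \<noteq> 0" "1 - y * r \<noteq> 0" "1 - y * (r * s) \<noteq> 0"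
      using y[of 0] y[of "Suc J"] y[of "J + l + 2"] by (simp_all only: rs r_def power_0 mult_1_right) auto
    thus ?thesis using nz unfolding rs r_def[symmetric] s_def[symmetric]
      by (simp add: divide_simps) (simp add: algebra_simps)
  qed
  moreover have "Suc J \<le> N" "J \<le> N" using Suc.prems by auto
  ultimately show ?case
    using Suc.IH unfolding sum.atMost_Suc signs
    by (simp only: S_def[symmetric] Y_pow idx(1,2,4) bins poch y_def[symmetric])
      (simp only: idx(3) Y_pow power_one_right poch)
qed simp

text \<open>The partial sum up to \<open>N - 1\<close> is the negative of the last summand, so all
  cancels unless \<open>N = 0\<close>. The subtraction in \<open>m + j - 1\<close> truncates only
  for \<open>m = j = 0\<close>, where that factor is empty.\<close>

lemma inversion_sum:
  "(\<Sum>j\<le>N. qbin q N j * (\<Prod>i<j. - (q ^ i)) /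
      (qpoch (Y * q ^ (m + 2 * j)) q (N - j) * qpoch (Y * q ^ (m + j - 1)) q j)) =
    (if N = 0 then 1 else 0)"
proof (cases N)
  case (Suc N')
  show ?thesis unfolding Suc sum.atMost_Suc inversion_partial_sum[OF order.refl]
    by (simp add: prod_neg_power_Suc mult_2 del: prod.lessThan_Suc)
qed simp

end

section \<open>Askey--Wilson polynomials in the Newton basis\<close>


text \<open>The complete homogeneous symmetric polynomial of degree \<open>N\<close> in
  \<open>x 0, ..., x (J - 1)\<close>; the recursion asks whether the last variable occurs.\<close>

fun hsym :: "(nat \<Rightarrow> 'f::comm_ring_1) \<Rightarrow> nat \<Rightarrow> nat \<Rightarrow> 'f" where
  "hsym x J 0 = 1"
| "hsym x 0 (Suc N) = 0"
| "hsym x (Suc J) (Suc N) = hsym x J (Suc N) + x J * hsym x (Suc J) N"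

definition newton_poly :: "(nat \<Rightarrow> 'f::comm_ring_1) \<Rightarrow> nat \<Rightarrow> 'f poly" where
  "newton_poly x m = (\<Prod>l<m. [:- x l, 1:])"

lemma newton_poly_Suc: "newton_poly x (Suc m) = [:0, 1:] * newton_poly x m - smult (x m) (newton_poly x m)"
  by (simp add: newton_poly_def algebra_simps)

text \<open>Divided differences of a power are complete homogeneous polynomials in the nodes. In the
  induction \<open>[:0, 1:] * newton_poly x m\<close> splits into two Newton polynomials, and the
  recursion of \<open>hsym\<close> collects the contributions.\<close>

lemma monom_eq_newton_sum:
  "monom 1 n = (\<Sum>m\<le>n. smult (hsym x (Suc m) (n - m)) (newton_poly x m))"
proof (induction n)
  case 0
  show ?case by (simp add: newton_poly_def)
next
  case (Suc n)
  have "monom 1 (Suc n) = [:0, 1:] * monom (1 :: 'a) n"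
    by (simp add: monom_Suc)
  also have "\<dots> = (\<Sum>m\<le>n. smult (hsym x (Suc m) (n - m)) (newton_poly x (Suc m))) +
      (\<Sum>m\<le>n. smult (x m * hsym x (Suc m) (n - m)) (newton_poly x m))"
    unfolding Suc sum_distrib_left sum.distrib[symmetric] newton_poly_Suc
    by (intro sum.cong refl) (simp add: smult_diff_right mult.commute)
  also have "(\<Sum>m\<le>n. smult (hsym x (Suc m) (n - m)) (newton_poly x (Suc m))) =
      (\<Sum>m\<le>Suc n. smult (hsym x m (Suc n - m)) (newton_poly x m))"
    by (simp add: sum.atMost_Suc_shift del: sum.atMost_Suc)
  also have "\<dots> = (\<Sum>m\<le>n. smult (hsym x m (Suc n - m)) (newton_poly x m)) + newton_poly x (Suc n)"
    by simp
  also have "\<dots> + (\<Sum>m\<le>n. smult (x m * hsym x (Suc m) (n - m)) (newton_poly x m)) =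
      (\<Sum>m\<le>n. smult (hsym x m (Suc n - m) + x m * hsym x (Suc m) (n - m)) (newton_poly x m)) +
      newton_poly x (Suc n)"
    by (simp add: sum.distrib smult_add_left)
  also have "(\<Sum>m\<le>n. smult (hsym x m (Suc n - m) + x m * hsym x (Suc m) (n - m)) (newton_poly x m)) =
      (\<Sum>m\<le>n. smult (hsym x (Suc m) (Suc n - m)) (newton_poly x m))"
    by (intro sum.cong refl) (simp add: Suc_diff_le)
  finally show ?case by simp
qed

text \<open>Principal specialisation: both sides obey the same Pascal rule. This is how Gaussian
  binomials arise from the layers \<open>t \<ge> 1\<close>, whose weights depend on \<open>j\<close>
  through \<open>q ^ j\<close>.\<close>

lemma (in non_root) hsym_power: "hsym (\<lambda>j. q ^ j) (Suc J) N = qbin q (J + N) J"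
proof (induction J arbitrary: N)
  case 0
  show ?case by (induction N) simp_all
next
  case (Suc J)
  show ?case
  proof (induction N)
    case (Suc N)
    show ?case
      using qbin_Pascal'[of "J + Suc N" J]
      by (simp add: \<open>\<And>N. hsym _ (Suc J) N = _\<close> Suc.IH del: hsym.simps(3) add: hsym.simps(3)[of _ "Suc J"])
  qed simp
qed

lemma smult_sum_right: "smult c (sum f S) = (\<Sum>i\<in>S. smult c (f i))"
  by (induction S rule: infinite_finite_induct) (simp_all add: smult_add_right)

lemma degree_newton_poly: "degree (newton_poly (x :: nat \<Rightarrow> 'f::idom) m) = m"
  and lead_coeff_newton_poly: "lead_coeff (newton_poly x m) = 1"
proof -
  show "lead_coeff (newton_poly x m) = 1"
    unfolding newton_poly_def by (simp add: lead_coeff_prod)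
  show "degree (newton_poly x m) = m"
    unfolding newton_poly_def by (subst degree_prod_eq_sum_degree) auto
qed

section \<open>Change of basis between Newton and Askey-Wilson polynomials\<close>

locale aw_params = generic_Y q "a * b * c * d" for a b c d q :: "'f::field" +
  assumes two_nonzero: "(2 :: 'f) \<noteq> 0" and a_nonzero: "a \<noteq> 0"
    and ab_generic: "a * b * q ^ n \<noteq> 1" and ac_generic: "a * c * q ^ n \<noteq> 1"
    and ad_generic: "a * d * q ^ n \<noteq> 1"
begin

text \<open>The powers of \<open>q\<close> are distinct. Infinitude makes \<open>aw_poly\<close>
  determined by its values.\<close>

lemma infinite_field: "infinite (UNIV :: 'f set)"
proof -
  have "inj (\<lambda>n. q ^ n)"
  proof (rule linorder_injI)
    fix m n :: nat assume "m < n"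
    hence "q ^ n = q ^ m * q ^ (n - m)" by (simp flip: power_add)
    thus "q ^ m \<noteq> q ^ n"
      using q_nonzero pow_q_neq_1[of "n - m"] \<open>m < n\<close> by simp
  qed
  thus ?thesis using finite_subset[OF subset_UNIV] infinite_UNIV_nat finite_imageD by metis
qed

text \<open>The values of \<open>x\<close> at which
  \<open>(1 - a * z * q ^ l) * (1 - a * inverse z * q ^ l)\<close> vanishes; they are also the
  weights of the layer \<open>t = 0\<close>.\<close>

definition node :: "nat \<Rightarrow> 'f" where
  "node l = (a * q ^ l + inverse a * inverse (q ^ l)) / 2"

definition \<rho> :: "nat \<Rightarrow> 'f" where
  "\<rho> i = (1 - a * b * q ^ i) * (1 - a * c * q ^ i) * (1 - a * d * q ^ i)"

text \<open>The coefficients of the Askey-Wilson polynomials in the Newton basis. The subtraction in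
  \<open>n + k - 1\<close> truncates only for \<open>n = k = 0\<close>, where that factor is
  empty.\<close>

definition aw_coeff :: "nat \<Rightarrow> nat \<Rightarrow> 'f" where
  "aw_coeff n k = mat_scale \<rho> (qbin q) n k * inverse (2 * a * q ^ k) ^ (n - k) /
     qpoch (a * b * c * d * q ^ (n + k - 1)) q (n - k)"

lemma qpoch_neg_power:
  assumes "k \<le> n"
  shows "qpoch (q powi (- int n)) q k / qpoch q q k = qbin q n k * (\<Prod>i<k. - (q ^ i)) * inverse (q ^ n) ^ k"
proof -
  \<comment> \<open>The claim with its denominators cleared, a form that admits induction on
    \<open>k\<close>.\<close>
  have "qpoch (q powi (- int n)) q k * qpoch q q (n - k) * (q ^ n) ^ k = qpoch q q n * (\<Prod>i<k. - (q ^ i))"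
    using assms
  proof (induction k)
    case (Suc k)
    define l where "l = n - Suc k"
    have n: "n = k + Suc l" using Suc.prems by (simp add: l_def)
    have d: "n - Suc k = l" "n - k = Suc l" using n by auto
    have "(1 - q powi (- int n) * q ^ k) * q ^ n = q ^ n - q ^ k"
      using q_nonzero by (simp add: power_int_minus field_simps)
    also have "\<dots> = - (q ^ k) * (1 - q * q ^ l)"
      by (simp add: n power_add algebra_simps)
    finally have e: "(1 - q powi (- int n) * q ^ k) * q ^ n = - (q ^ k) * (1 - q * q ^ l)" .
    have "qpoch (q powi (- int n)) q (Suc k) * qpoch q q l * (q ^ n) ^ Suc k =
        qpoch (q powi (- int n)) q k * qpoch q q l * (q ^ n) ^ k * ((1 - q powi (- int n) * q ^ k) * q ^ n)"
      by (simp add: qpoch_Suc mult_ac)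
    also have "\<dots> = qpoch (q powi (- int n)) q k * (qpoch q q l * (1 - q * q ^ l)) * (q ^ n) ^ k * - (q ^ k)"
      unfolding e by (simp add: mult_ac)
    also have "\<dots> = qpoch q q n * (\<Prod>i<Suc k. - (q ^ i))"
      using Suc by (simp add: qpoch_Suc d)
    finally show ?case by (simp add: d)
  qed simp
  thus ?thesis
    using assms q_nonzero by (simp add: qbin_def field_simps)
qed

text \<open>Each factor of \<open>qpoch_pair\<close> is linear in \<open>x\<close> with leading
  coefficient \<open>- 2 * a * q ^ i\<close> and root \<open>node i\<close>.\<close>

lemma prod_node:
  assumes "z \<noteq> 0"
  shows "qpoch (a * z) q k * qpoch (a * inverse z) q k =
    (\<Prod>i<k. - (2 * a * q ^ i)) * poly (newton_poly node k) ((z + inverse z) / 2)"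
  unfolding qpoch_pair[OF two_nonzero assms] newton_poly_def poly_prod prod.distrib[symmetric]
proof (intro prod.cong refl)
  fix i
  define t where "t = a * q ^ i"
  have "2 * t * node i = t * t + 1"
    using two_nonzero a_nonzero q_nonzero by (simp add: node_def t_def field_simps)
  moreover have "a\<^sup>2 * q ^ (2 * i) = t * t" "2 * a * q ^ i = 2 * t" "- 2 * a * q ^ i = - (2 * t)"
    by (simp_all add: t_def power_even_eq power_mult_distrib flip: power2_eq_square)
  ultimately show "poly [:1 + a\<^sup>2 * q ^ (2 * i), - 2 * a * q ^ i:] ((z + inverse z) / 2) =
      - (2 * a * q ^ i) * poly [:- node i, 1:] ((z + inverse z) / 2)"
    by (simp only: poly_pCons) (simp add: algebra_simps)
qed

text \<open>Both sides are compared at \<open>x = (z + inverse z) / 2\<close>, summand by summand in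
  the terminating series.\<close>

lemma aw_poly_eq: "aw_poly n a b c d q = (\<Sum>k\<le>n. smult (aw_coeff n k) (newton_poly node k))"
proof (rule aw_poly_unique[OF two_nonzero infinite_field])
  fix z :: 'f assume z: "z \<noteq> 0"
  define X where "X = (z + inverse z) / 2"
  define C where "C = (qpoch (a * b) q n * qpoch (a * c) q n * qpoch (a * d) q n) /
     (2 ^ n * a ^ n * qpoch (a * b * c * d * q powi (int n - 1)) q n)"
  define f where "f = (\<lambda>k. (qpoch (q powi (- int n)) q k * qpoch (a * b * c * d * q powi (int n - 1)) q k *
      qpoch (a * z) q k * qpoch (a * inverse z) q k) /
      (qpoch q q k * qpoch (a * b) q k * qpoch (a * c) q k * qpoch (a * d) q k) * q ^ k)"
  have "aw_expr n a b c d q z = C * Sum_any f"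
    by (simp only: aw_expr_def phi43_def C_def f_def)
  also have "Sum_any f = (\<Sum>k\<le>n. f k)"
  proof (rule Sum_any.expand_superset)
    have "f k = 0" if "n < k" for k
      by (simp add: f_def qpoch_neg_power_eq_0[OF q_nonzero that])
    thus "{k. f k \<noteq> 0} \<subseteq> {..n}" by (force simp: not_le[symmetric])
  qed simp
  also have "C * \<dots> = (\<Sum>k\<le>n. aw_coeff n k * poly (newton_poly node k) X)"
    unfolding sum_distrib_left
  proof (intro sum.cong refl)
    fix k assume "k \<in> {..n}"
    hence k: "k \<le> n" by simp
    define l where "l = n - k"
    have n: "n = k + l" using k by (simp add: l_def)
    have qz: "qpoch (a * z) q k * qpoch (a * inverse z) q k =
        (2 * a) ^ k * (\<Prod>i<k. - (q ^ i)) * poly (newton_poly node k) X"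
      unfolding prod_node[OF z] X_def
      by (simp add: prod_uminus prod.distrib power_mult_distrib)
    have nz: "qpoch (a * b) q m \<noteq> 0" "qpoch (a * c) q m \<noteq> 0" "qpoch (a * d) q m \<noteq> 0" for m
      by (intro qpoch_nonzero ab_generic ac_generic ad_generic)+
    have split: "qpoch (a * u) q n = qpoch (a * u) q k * (\<Prod>i=k..<n. 1 - a * u * q ^ i)" for u
      unfolding n qpoch_add qpoch_shift ..
    \<comment> \<open>For \<open>n = 0\<close> the exponent \<open>int n - 1\<close> is negative,
      but then \<open>k = 0\<close> and all factors are empty.\<close>
    have Yl: "qpoch (a * b * c * d * q powi (int n - 1)) q k /
        qpoch (a * b * c * d * q powi (int n - 1)) q n =
        1 / qpoch (a * b * c * d * q ^ (n + k - 1)) q (n - k)"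
    proof (cases n)
      case (Suc n')
      have p: "q powi (int n - 1) = q ^ n'" by (simp add: Suc)
      have "qpoch (a * b * c * d * q ^ n') q n = qpoch (a * b * c * d * q ^ n') q k *
          qpoch (a * b * c * d * q ^ n' * q ^ k) q (n - k)"
        using qpoch_add[of "a * b * c * d * q ^ n'" q k l] by (simp add: n)
      moreover have "a * b * c * d * q ^ n' * q ^ k = a * b * c * d * q ^ (n + k - 1)"
        by (simp add: Suc power_add mult_ac)
      ultimately show ?thesis unfolding p by simp
    qed (use k in simp)
    have pw: "(\<Prod>i<k. - (q ^ i)) * (\<Prod>i<k. - (q ^ i)) * inverse (q ^ n) ^ k * q ^ k * (2 * a) ^ k / (2 ^ n * a ^ n) =
        inverse (2 * a * q ^ k) ^ (n - k)"
    proof -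
      \<comment> \<open>The signs cancel in pairs, and the exponents add up to
        \<open>j * (j - 1) + j = j * j\<close>.\<close>
      have "(\<Prod>i<j. - (q ^ i)) * (\<Prod>i<j. - (q ^ i)) * q ^ j = (q ^ j) ^ j" for j
        by (induction j) (simp_all add: power_add power_mult_distrib algebra_simps)
      hence "(\<Prod>i<k. - (q ^ i)) * (\<Prod>i<k. - (q ^ i)) * q ^ k = (q ^ k) ^ k" .
      moreover have "(q ^ n) ^ k = (q ^ k) ^ k * (q ^ k) ^ l"
        by (simp add: n power_add power_mult_distrib flip: power_mult) (simp add: mult.commute)
      ultimately show ?thesis
        using q_nonzero a_nonzero two_nonzero unfolding l_def[symmetric]
        by (simp add: n power_add power_mult_distrib field_simps)
    qed
    have "C * f k = (qpoch (q powi (- int n)) q k / qpoch q q k) *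
        (qpoch (a * z) q k * qpoch (a * inverse z) q k) * q ^ k *
        (qpoch (a * b * c * d * q powi (int n - 1)) q k / qpoch (a * b * c * d * q powi (int n - 1)) q n) *
        (qpoch (a * b) q n / qpoch (a * b) q k) * (qpoch (a * c) q n / qpoch (a * c) q k) *
        (qpoch (a * d) q n / qpoch (a * d) q k) / (2 ^ n * a ^ n)"
      by (simp add: C_def f_def mult_ac)
    also have "\<dots> = qbin q n k * (\<Prod>i=k..<n. \<rho> i) * poly (newton_poly node k) X /
        qpoch (a * b * c * d * q ^ (n + k - 1)) q (n - k) *
        ((\<Prod>i<k. - (q ^ i)) * (\<Prod>i<k. - (q ^ i)) * inverse (q ^ n) ^ k * q ^ k * (2 * a) ^ k / (2 ^ n * a ^ n))"
      unfolding qpoch_neg_power[OF k] qz Yl split \<rho>_def prod.distrib using nz[of k]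
      by (simp add: mult_ac)
    finally show "C * f k = aw_coeff n k * poly (newton_poly node k) X"
      unfolding pw by (simp add: aw_coeff_def mat_scale_def mult_ac)
  qed
  finally show "poly (aw_poly n a b c d q) ((z + inverse z) / 2) =
      poly (\<Sum>k\<le>n. smult (aw_coeff n k) (newton_poly node k)) ((z + inverse z) / 2)"
    unfolding poly_aw_poly[OF two_nonzero infinite_field q_nonzero z] by (simp add: poly_sum X_def)
qed

text \<open>The column weight of the layer \<open>t = 1\<close>; the same factors turn up in the
  inversion of \<open>aw_coeff\<close>.\<close>

definition \<omega> :: "nat \<Rightarrow> 'f" where
  "\<omega> i = - inverse (2 * a * q ^ i)"

text \<open>All column weights combine to the constant \<open>K\<close>, independent of the
  summation index, and \<open>inversion_sum\<close> does the rest. Thus \<open>conn\<close> inverts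
  \<open>aw_coeff\<close>.\<close>

lemma conn_aw_coeff:
  assumes "m \<le> n"
  shows "(\<Sum>k=m..n. conn (\<lambda>i. \<omega> i * \<rho> i) n k * aw_coeff k m) = (if n = m then 1 else 0)"
proof -
  define K where "K = (\<Prod>i=m..<n. \<omega> i * \<rho> i)"
  define g where "g k = (\<Prod>i<k-m. - (q ^ i)) / (qpoch (a * b * c * d * q ^ (2 * k)) q (n - k) *
      qpoch (a * b * c * d * q ^ (k + m - 1)) q (k - m))" for k
  have \<omega>nz: "\<omega> i \<noteq> 0" for i
    using a_nonzero q_nonzero two_nonzero by (simp add: \<omega>_def)
  have "conn (\<lambda>i. \<omega> i * \<rho> i) n k * aw_coeff k m = qbin q n k * qbin q k m * (g k * K)"
    if "k \<in> {m..n}" for k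
  proof -
    have "(\<Prod>i=m..<k. \<omega> i) * (\<Prod>i<k-m. - (q ^ i)) = inverse (2 * a * q ^ m) ^ (k - m)"
    proof -
      \<comment> \<open>The powers of \<open>q\<close> in \<open>\<omega> (m + i)\<close> and
        \<open>- (q ^ i)\<close> cancel up to \<open>q ^ m\<close>, so all factors are
        equal.\<close>
      have "(\<Prod>i=m..<m+(k-m). \<omega> i) * (\<Prod>i<k-m. - (q ^ i)) = (\<Prod>i<k-m. inverse (2 * a * q ^ m))"
        unfolding prod_shift prod.distrib[symmetric] \<omega>_def using q_nonzero
        by (intro prod.cong refl) (simp add: power_add)
      thus ?thesis using that by simp
    qed
    hence *: "inverse (2 * a * q ^ m) ^ (k - m) = (\<Prod>i=m..<k. \<omega> i) * (\<Prod>i<k-m. - (q ^ i))" ..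
    have **: "K = (\<Prod>i=m..<k. \<omega> i) * (\<Prod>i=m..<k. \<rho> i) * (\<Prod>i=k..<n. \<omega> i * \<rho> i)"
      using that by (simp add: K_def prod.distrib[symmetric] prod.atLeastLessThan_concat)
    show ?thesis
      unfolding conn_def aw_coeff_def mat_scale_def g_def * ** by (simp add: mult_ac)
  qed
  hence "(\<Sum>k=m..n. conn (\<lambda>i. \<omega> i * \<rho> i) n k * aw_coeff k m) = (\<Sum>k=m..n. qbin q n k * qbin q k m * (g k * K))"
    by simp
  also have "\<dots> = qbin q n m * (\<Sum>j\<le>n-m. qbin q (n - m) j * g (m + j)) * K"
    unfolding sum_qbin_shift[OF assms, symmetric] by (simp add: sum_distrib_right mult.assoc)
  also have "(\<Sum>j\<le>n-m. qbin q (n - m) j * g (m + j)) = (if n - m = 0 then 1 else 0)"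
  proof -
    \<comment> \<open>These exponents are those of \<open>inversion_sum\<close> with
      \<open>2 * m\<close> in the place of \<open>m\<close>.\<close>
    have idx: "2 * (m + j) = 2 * m + 2 * j" "n - (m + j) = n - m - j" "m + j + m - 1 = 2 * m + j - 1" for j
    by auto
    show ?thesis unfolding g_def idx inversion_sum[of "n - m" "2 * m", symmetric] by simp
  qed
  finally show ?thesis using assms by (auto simp: K_def)
qed

lemma newton_poly_eq_sum_aw_poly:
  "newton_poly node n = (\<Sum>k\<le>n. smult (conn (\<lambda>i. \<omega> i * \<rho> i) n k) (aw_poly k a b c d q))"
proof -
  have "(\<Sum>k\<le>n. smult (conn (\<lambda>i. \<omega> i * \<rho> i) n k) (aw_poly k a b c d q)) =
      (\<Sum>k\<le>n. \<Sum>m\<le>k. smult (conn (\<lambda>i. \<omega> i * \<rho> i) n k * aw_coeff k m) (newton_poly node m))"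
    by (simp add: aw_poly_eq smult_sum_right)
  also have "\<dots> = (\<Sum>m\<le>n. \<Sum>k=m..n. smult (conn (\<lambda>i. \<omega> i * \<rho> i) n k * aw_coeff k m) (newton_poly node m))"
    unfolding sum.Sigma[OF finite_atMost ballI[OF finite_atMost]]
      sum.Sigma[OF finite_atMost ballI[OF finite_atLeastAtMost]]
    by (rule sum.reindex_bij_witness[of _ "\<lambda>(x, y). (y, x)" "\<lambda>(x, y). (y, x)"]) auto
  also have "\<dots> = (\<Sum>m\<le>n. smult (if n = m then 1 else 0) (newton_poly node m))"
    by (intro sum.cong refl) (simp add: conn_aw_coeff flip: smult_sum)
  also have "\<dots> = (\<Sum>m\<le>n. if m = n then newton_poly node m else 0)"
    by (intro sum.cong refl) auto
  finally show ?thesis by simp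
qed

text \<open>Newton interpolation followed by the change of basis gives an expansion of the required
  shape. The rest is its uniqueness, since the moments are defined by a definite
  description.\<close>

lemma aw_mixed_moment_eq:
  assumes "k \<le> n"
  shows "aw_mixed_moment a b c d q n k =
    mat_mult (\<lambda>n m. hsym node (Suc m) (n - m)) (conn (\<lambda>i. \<omega> i * \<rho> i)) n k"
proof -
  let ?s = "\<lambda>k. if k \<le> n then mat_mult (\<lambda>n m. hsym node (Suc m) (n - m)) (conn (\<lambda>i. \<omega> i * \<rho> i)) n k else 0"
  let ?p = "\<lambda>k. aw_poly k a b c d q"
  have "monom 1 n = (\<Sum>m\<le>n. \<Sum>k\<le>m. smult (hsym node (Suc m) (n - m) * conn (\<lambda>i. \<omega> i * \<rho> i) m k) (?p k))"
    unfolding monom_eq_newton_sum[of n node] newton_poly_eq_sum_aw_poly by (simp add: smult_sum_right)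
  also have "\<dots> = (\<Sum>k\<le>n. \<Sum>m=k..n. smult (hsym node (Suc m) (n - m) * conn (\<lambda>i. \<omega> i * \<rho> i) m k) (?p k))"
    unfolding sum.Sigma[OF finite_atMost ballI[OF finite_atMost]]
      sum.Sigma[OF finite_atMost ballI[OF finite_atLeastAtMost]]
    by (rule sum.reindex_bij_witness[of _ "\<lambda>(x, y). (y, x)" "\<lambda>(x, y). (y, x)"]) auto
  also have "\<dots> = (\<Sum>k\<le>n. smult (?s k) (?p k))"
    by (intro sum.cong refl) (simp add: mat_mult_def smult_sum)
  finally have s: "(\<forall>k>n. ?s k = 0) \<and> monom 1 n = (\<Sum>k\<le>n. smult (?s k) (?p k))" by simp
  \<comment> \<open>The diagonal of \<open>aw_coeff\<close> is 1, so the polynomial with index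
    \<open>k\<close> is monic of degree \<open>k\<close>.\<close>
  have coeff_p: "coeff (?p k) j = (if j = k then 1 else 0)" if "k \<le> j" for j k
  proof -
    have "coeff (newton_poly node m) j = 0" if "m < j" for m
      using that by (simp add: coeff_eq_0 degree_newton_poly)
    hence "coeff (?p k) j = (\<Sum>m\<le>k. if m = k \<and> j = k then 1 else 0)"
      unfolding aw_poly_eq coeff_sum using that lead_coeff_newton_poly[of node k]
      by (intro sum.cong refl) (auto simp: degree_newton_poly aw_coeff_def mat_scale_def)
    thus ?thesis by auto
  qed
  have "s' = s''" if "(\<forall>k>n. s' k = 0) \<and> monom 1 n = (\<Sum>k\<le>n. smult (s' k) (?p k))"
    "(\<forall>k>n. s'' k = 0) \<and> monom 1 n = (\<Sum>k\<le>n. smult (s'' k) (?p k))" for s' s''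
  proof (rule ccontr)
    assume "s' \<noteq> s''"
    define D where "D = {k. s' k \<noteq> s'' k}"
    have D: "D \<subseteq> {..n}" "D \<noteq> {}" using that \<open>s' \<noteq> s''\<close> by (auto simp: D_def not_le[symmetric])
    \<comment> \<open>In degree \<open>K\<close>, the largest index where two expansions differ,
      only the summand \<open>k = K\<close> survives.\<close>
    define K where "K = Max D"
    have K: "K \<in> D" "\<And>k. k \<in> D \<Longrightarrow> k \<le> K"
      using D finite_subset[OF D(1)] by (auto simp: K_def)
    have "(\<Sum>k\<le>n. smult (s' k) (?p k)) = (\<Sum>k\<le>n. smult (s'' k) (?p k))" using that by simp
    hence "(\<Sum>k\<le>n. (s' k - s'' k) * coeff (?p k) K) = 0"
      by (simp add: poly_eq_iff coeff_sum left_diff_distrib sum_subtractf)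
    also have "(\<Sum>k\<le>n. (s' k - s'' k) * coeff (?p k) K) = (\<Sum>k\<le>n. if k = K then s' k - s'' k else 0)"
    proof (intro sum.cong refl)
      fix k
      show "(s' k - s'' k) * coeff (?p k) K = (if k = K then s' k - s'' k else 0)"
        using K(2)[of k] coeff_p[of k K] by (cases "k \<le> K") (auto simp: D_def)
    qed
    finally show False using K(1) D(1) by (auto simp: D_def)
  qed
  from the_equality[of "\<lambda>s. (\<forall>k>n. s k = 0) \<and> monom 1 n = (\<Sum>k\<le>n. smult (s k) (?p k))", OF s this] s
  have "mixed_moment ?p n = ?s" unfolding mixed_moment_def by blast
  thus ?thesis using assms by (simp add: aw_mixed_moment_def)
qed

end

section \<open>Paths as sequences of east steps\<close>


text \<open>A key \<open>\<kappa> = t * N + j\<close> encodes \<open>(t, j)\<close> by one integer,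
  with \<open>N\<close> above all columns in use. An east step keeps the key; the legal keys of
  column \<open>c\<close> satisfy \<open>\<kappa> mod N \<le> c\<close>.\<close>

definition key_vertex :: "nat \<Rightarrow> nat \<Rightarrow> nat \<Rightarrow> nat \<times> real" where
  "key_vertex N c \<kappa> = lh_vertex (\<kappa> div N) c (\<kappa> mod N)"

definition next_key :: "nat \<Rightarrow> nat \<Rightarrow> nat \<Rightarrow> nat" where
  "next_key N c \<kappa> = (if \<kappa> mod N < c then Suc \<kappa> else Suc (\<kappa> div N) * N)"

text \<open>Height times \<open>i + 1\<close> is \<open>t * (i + 1) + j\<close>, from which division
  with remainder recovers \<open>t\<close> and \<open>j\<close>.\<close>

lemma lh_vertex_inj:
  assumes "lh_vertex t i j = lh_vertex t' i' j'" and "j \<le> i" "j' \<le> i'"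
  shows "t = t' \<and> i = i' \<and> j = j'"
proof -
  have i: "i' = i" using assms(1) by (simp add: lh_vertex_def)
  have "real t + real j / real (i + 1) = real t' + real j' / real (i + 1)"
    using assms(1) by (simp add: lh_vertex_def i)
  hence "real (t * (i + 1) + j) = real (t' * (i + 1) + j')"
    unfolding of_nat_add of_nat_mult by (simp add: field_simps)
  hence eq: "t * (i + 1) + j = t' * (i + 1) + j'" by (simp only: of_nat_eq_iff)
  have "(t * (i + 1) + j) div (i + 1) = t" "(t' * (i + 1) + j') div (i + 1) = t'"
    using assms(2,3) i by (simp_all add: div_mult_self3 del: mult_Suc_right add_Suc_right)
  with eq have "t = t'" by metis
  thus ?thesis using eq i by simp
qed

lemma key_vertex_inj:
  "key_vertex N c \<kappa> = key_vertex N c' \<kappa>' \<Longrightarrow> \<kappa> mod N \<le> c \<Longrightarrow> \<kappa>' mod N \<le> c' \<Longrightarrow> c = c' \<and> \<kappa> = \<kappa>'"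
  unfolding key_vertex_def by (metis div_mult_mod_eq lh_vertex_inj)

lemma key_vertex_next_key:
  assumes "\<kappa> mod N \<le> c" and "c < N"
  shows "key_vertex N c (next_key N c \<kappa>) = lh_vertex (\<kappa> div N) c (\<kappa> mod N + 1)"
proof (cases "\<kappa> mod N < c")
  case True
  hence "Suc (\<kappa> mod N) \<noteq> N" using assms by simp
  thus ?thesis using True by (simp add: key_vertex_def next_key_def div_Suc mod_Suc)
next
  case False
  hence "\<kappa> mod N = c" using assms by simp
  thus ?thesis using False assms lh_vertex_Suc[of "\<kappa> div N" c]
    by (simp add: key_vertex_def next_key_def del: mult_Suc)
qed

lemma less_next_key: "0 < N \<Longrightarrow> \<kappa> < next_key N c \<kappa>"
  unfolding next_key_def by (simp add: dividend_less_div_times del: mult_Suc) (metis dividend_less_div_times mult_Suc)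

lemma next_key_mod: "next_key N c \<kappa> mod N \<le> c"
  by (auto simp: next_key_def mod_Suc simp del: mult_Suc)

text \<open>There is no legal key strictly between \<open>\<kappa>\<close> and its successor: only
  remainders above \<open>c\<close> are skipped.\<close>

lemma next_key_le:
  assumes "\<kappa> < \<kappa>'" and "\<kappa>' mod N \<le> c"
  shows "next_key N c \<kappa> \<le> \<kappa>'"
proof (cases "\<kappa> mod N < c")
  case False
  have "\<kappa> div N \<noteq> \<kappa>' div N"
    using assms False by (metis add_less_cancel_left div_mult_mod_eq leD le_trans linorder_not_le)
  moreover have "\<kappa> div N \<le> \<kappa>' div N" using assms by (intro div_le_mono) simp
  ultimately have "Suc (\<kappa> div N) * N \<le> \<kappa>' div N * N" by (intro mult_le_mono1) simp
  also have "\<dots> \<le> \<kappa>'" by simp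
  finally show ?thesis using False by (simp add: next_key_def)
qed (use assms in \<open>simp add: next_key_def\<close>)

text \<open>The remainder is divided by \<open>c + 1 \<le> N\<close>. The bound transfers divergence
  from keys to heights.\<close>

lemma snd_key_vertex_ge:
  assumes "c < N"
  shows "real \<kappa> / real N \<le> snd (key_vertex N c \<kappa>)"
proof -
  have "real \<kappa> = real (\<kappa> div N * N + \<kappa> mod N)" by simp
  also have "\<dots> = real (\<kappa> div N) * real N + real (\<kappa> mod N)" by (simp only: of_nat_add of_nat_mult)
  finally have "real \<kappa> / real N = real (\<kappa> div N) + real (\<kappa> mod N) / real N"
    using assms by (simp add: field_simps)
  also have "\<dots> \<le> real (\<kappa> div N) + real (\<kappa> mod N) / real (c + 1)"
    using assms by (intro add_left_mono divide_left_mono) auto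
  finally show ?thesis by (simp add: key_vertex_def lh_vertex_def)
qed

text \<open>Here \<open>s i\<close> is the key of the east step from column \<open>i\<close> to
  \<open>i + 1\<close>. Paths descend eastwards, so keys decrease weakly; extensionality makes the
  encoding unique.\<close>

definition key_seqs :: "nat \<Rightarrow> nat \<Rightarrow> nat \<Rightarrow> (nat \<Rightarrow> nat) set" where
  "key_seqs N k n = {s \<in> extensional {k..<n}.
     (\<forall>i\<in>{k..<n}. s i mod N \<le> i) \<and> (\<forall>i. k \<le> i \<longrightarrow> Suc i < n \<longrightarrow> s (Suc i) \<le> s i)}"

lemma key_seqs_antimono:
  assumes "s \<in> key_seqs N k n" and "k \<le> i" "i \<le> j" "j < n"
  shows "s j \<le> s i"
  using assms(3,4)
proof (induction j rule: dec_induct)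
  case (step j)
  have "s (Suc j) \<le> s j" using assms(1,2) step by (auto simp: key_seqs_def)
  thus ?case using step by simp
qed simp

text \<open>One backward step of the encoded path: west once the key of the next crossing is
  reached, otherwise up to the next vertex.\<close>

definition walk_step :: "nat \<Rightarrow> nat \<Rightarrow> (nat \<Rightarrow> nat) \<Rightarrow> nat \<times> nat \<Rightarrow> nat \<times> nat" where
  "walk_step N k s = (\<lambda>(c, \<kappa>). if k < c \<and> s (c - 1) = \<kappa> then (c - 1, \<kappa>) else (c, next_key N c \<kappa>))"

definition walk :: "nat \<Rightarrow> nat \<Rightarrow> nat \<Rightarrow> (nat \<Rightarrow> nat) \<Rightarrow> nat \<Rightarrow> nat \<times> nat" where
  "walk N k n s m = (walk_step N k s ^^ m) (n, 0)"

definition walk_path :: "nat \<Rightarrow> nat \<Rightarrow> nat \<Rightarrow> (nat \<Rightarrow> nat) \<Rightarrow> nat \<Rightarrow> nat \<times> real" where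
  "walk_path N k n s m = (case walk N k n s m of (c, \<kappa>) \<Rightarrow> key_vertex N c \<kappa>)"

lemma walk_0 [simp]: "walk N k n s 0 = (n, 0)"
  and walk_Suc: "walk N k n s (Suc m) = walk_step N k s (walk N k n s m)"
  by (simp_all add: walk_def)

text \<open>A discrete intermediate value argument: descents of at most one skip no value.\<close>

lemma unit_descent_crossing:
  fixes f :: "nat \<Rightarrow> nat"
  assumes "\<And>m. f m \<le> Suc (f (Suc m))" and "f M \<le> i" "i < f 0"
  shows "\<exists>m<M. f m = Suc i \<and> f (Suc m) = i"
  using assms(2)
proof (induction M)
  case (Suc M)
  show ?case
  proof (cases "f M \<le> i")
    case False
    hence "f M = Suc i" "f (Suc M) = i" using assms(1)[of M] Suc.prems by auto
    thus ?thesis by blast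
  qed (use Suc.IH less_SucI in blast)
qed (use assms(3) in simp)

lemma walk_column_step:
  "fst (walk N k n s (Suc m)) \<le> fst (walk N k n s m)"
  "fst (walk N k n s m) \<le> Suc (fst (walk N k n s (Suc m)))"
  by (auto simp: walk_Suc walk_step_def split: prod.split)

section \<open>Bijection between key sequences and paths\<close>

context
  fixes N k n :: nat
  assumes kn: "k \<le> n" and nN: "n < N"
begin

text \<open>By \<open>next_key_le\<close> the key cannot overtake \<open>s (c - 1)\<close>, so no
  crossing is missed. The last bound holds because each step goes one column west or increases the
  key.\<close>

lemma walk_invariant:
  assumes s: "s \<in> key_seqs N k n" and "walk N k n s m = (c, \<kappa>)"
  shows "k \<le> c" "c \<le> n" "\<kappa> mod N \<le> c" "k < c \<Longrightarrow> \<kappa> \<le> s (c - 1)" "m \<le> \<kappa> + (n - c)"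
proof -
  have "k \<le> c \<and> c \<le> n \<and> \<kappa> mod N \<le> c \<and> (k < c \<longrightarrow> \<kappa> \<le> s (c - 1)) \<and> m \<le> \<kappa> + (n - c)"
    using assms(2)
  proof (induction m arbitrary: c \<kappa>)
    case 0
    thus ?case using kn by simp
  next
    case (Suc m)
    obtain c' \<kappa>' where w: "walk N k n s m = (c', \<kappa>')" by fastforce
    note IH = Suc.IH[OF w]
    have s_mod: "s i mod N \<le> i" if "k \<le> i" "i < n" for i
      using s that by (simp add: key_seqs_def)
    show ?case
    proof (cases "k < c' \<and> s (c' - 1) = \<kappa>'")
      case True
      hence c: "c' = Suc c" "\<kappa> = \<kappa>'" "s c = \<kappa>" using Suc.prems by (auto simp: walk_Suc w walk_step_def)
      moreover have "k \<le> c" "c < n" using True IH c by auto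
      moreover have "s c \<le> s (c - 1)" if "k < c"
        using key_seqs_antimono[OF s, of "c - 1" c] that \<open>c < n\<close> by simp
      ultimately show ?thesis using IH s_mod[of c] by auto
    next
      case False
      hence c: "c' = c" "\<kappa> = next_key N c \<kappa>'" using Suc.prems by (auto simp: walk_Suc w walk_step_def)
      have "next_key N c \<kappa>' \<le> s (c - 1)" if "k < c"
      proof (rule next_key_le)
        show "\<kappa>' < s (c - 1)" using that IH False c by auto
        have "s (c - 1) mod N \<le> c - 1" using that IH c by (intro s_mod) auto
        thus "s (c - 1) mod N \<le> c" using diff_le_self by (rule order_trans)
      qed
      thus ?thesis
        using IH c next_key_mod[of N c \<kappa>'] less_next_key[of N \<kappa>' c] nN by auto
    qed
  qed
  thus "k \<le> c" "c \<le> n" "\<kappa> mod N \<le> c" "k < c \<Longrightarrow> \<kappa> \<le> s (c - 1)" "m \<le> \<kappa> + (n - c)" by auto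
qed

lemma walk_column_eventually:
  assumes s: "s \<in> key_seqs N k n" and m: "s k + n < m"
  shows "fst (walk N k n s m) = k"
proof (rule ccontr)
  obtain c \<kappa> where w: "walk N k n s m = (c, \<kappa>)" by fastforce
  note inv = walk_invariant[OF s w]
  assume "fst (walk N k n s m) \<noteq> k"
  hence "k < c" using inv w by auto
  hence "\<kappa> \<le> s (c - 1)" "s (c - 1) \<le> s k"
    using inv key_seqs_antimono[OF s, of k "c - 1"] by auto
  thus False using inv m by simp
qed

lemma walk_crossing:
  assumes s: "s \<in> key_seqs N k n" and i: "k \<le> i" "i < n"
  shows "\<exists>m. walk N k n s m = (Suc i, s i) \<and> walk N k n s (Suc m) = (i, s i)"
proof -
  obtain m where m: "fst (walk N k n s m) = Suc i" "fst (walk N k n s (Suc m)) = i"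
    using unit_descent_crossing[of "\<lambda>m. fst (walk N k n s m)" "Suc (s k + n)" i]
      walk_column_step(2) walk_column_eventually[OF s] i by fastforce
  thus ?thesis
    by (cases "walk N k n s m") (auto simp: walk_Suc walk_step_def split: if_splits)
qed

lemma walk_crossing_unique:
  assumes "walk N k n s m = (Suc i, \<kappa>)" and "fst (walk N k n s (Suc m)) = i"
  shows "k \<le> i \<and> s i = \<kappa>"
  using assms by (auto simp: walk_Suc walk_step_def split: if_splits)

lemma walk_path_steps:
  assumes s: "s \<in> key_seqs N k n"
  shows "south_step (walk_path N k n s (Suc m)) (walk_path N k n s m) \<or>
    east_step (walk_path N k n s (Suc m)) (walk_path N k n s m)"
proof -
  obtain c \<kappa> where w: "walk N k n s m = (c, \<kappa>)" by fastforce
  obtain c' \<kappa>' where w': "walk N k n s (Suc m) = (c', \<kappa>')" by fastforce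
  note inv = walk_invariant[OF s w] and inv' = walk_invariant[OF s w']
  show ?thesis
  proof (cases "k < c \<and> s (c - 1) = \<kappa>")
    case True
    hence c: "c = Suc c'" "\<kappa>' = \<kappa>" using w' by (auto simp: walk_Suc w walk_step_def)
    hence "\<kappa> mod N \<le> c'" using inv' by simp
    thus ?thesis unfolding east_step_def walk_path_def w w' key_vertex_def by (auto simp: c)
  next
    case False
    hence c: "c' = c" "\<kappa>' = next_key N c \<kappa>" using w' by (auto simp: walk_Suc w walk_step_def)
    have "walk_path N k n s (Suc m) = lh_vertex (\<kappa> div N) c (\<kappa> mod N + 1)"
      unfolding walk_path_def w' using key_vertex_next_key[of \<kappa> N c] inv nN by (simp add: c)
    thus ?thesis using inv(3) unfolding south_step_def
      by (auto simp: walk_path_def w key_vertex_def)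
  qed
qed

lemma walk_path_in_SE_paths:
  assumes s: "s \<in> key_seqs N k n"
  shows "walk_path N k n s \<in> SE_paths k n"
proof -
  have fst_eq: "fst (walk_path N k n s m) = fst (walk N k n s m)" for m
    by (simp add: walk_path_def key_vertex_def lh_vertex_def split: prod.split)
  have "(\<lambda>m. fst (walk_path N k n s m)) \<longlonglongrightarrow> k"
    unfolding fst_eq using walk_column_eventually[OF s]
    by (intro tendsto_eventually eventually_sequentiallyI[of "Suc (s k + n)"]) auto
  moreover have "filterlim (\<lambda>m. snd (walk_path N k n s m)) at_top sequentially"
    unfolding filterlim_at_top
  proof
    fix Z :: real
    \<comment> \<open>The threshold comes from \<open>\<kappa> \<ge> m - n\<close> and the height
      being at least \<open>\<kappa> / N\<close>.\<close>
    have "Z \<le> snd (walk_path N k n s m)" if m: "nat \<lceil>Z * N + n\<rceil> \<le> m" for m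
    proof -
      obtain c \<kappa> where w: "walk N k n s m = (c, \<kappa>)" by fastforce
      note inv = walk_invariant[OF s w]
      have "Z * N + n \<le> real m" using m by linarith
      also have "\<dots> \<le> real \<kappa> + real n" using inv by linarith
      finally have "Z \<le> real \<kappa> / real N" using nN by (simp add: field_simps)
      thus ?thesis using snd_key_vertex_ge[of c N \<kappa>] inv nN by (simp add: walk_path_def w)
    qed
    thus "eventually (\<lambda>m. Z \<le> snd (walk_path N k n s m)) sequentially"
      by (rule eventually_sequentiallyI)
  qed
  ultimately show ?thesis
    using walk_path_steps[OF s] by (simp add: SE_paths_def walk_path_def key_vertex_def lh_vertex_def)
qed

lemma inj_on_walk_path: "inj_on (walk_path N k n) (key_seqs N k n)"
proof (rule inj_onI)
  fix s s' assume s: "s \<in> key_seqs N k n" and s': "s' \<in> key_seqs N k n"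
    and eq: "walk_path N k n s = walk_path N k n s'"
  have w: "walk N k n s m = walk N k n s' m" for m
  proof -
    obtain c \<kappa> where 1: "walk N k n s m = (c, \<kappa>)" by fastforce
    obtain c' \<kappa>' where 2: "walk N k n s' m = (c', \<kappa>')" by fastforce
    have "key_vertex N c \<kappa> = key_vertex N c' \<kappa>'"
      using fun_cong[OF eq, of m] by (simp add: walk_path_def 1 2)
    from key_vertex_inj[OF this] show ?thesis
      using walk_invariant(3)[OF s 1] walk_invariant(3)[OF s' 2] 1 2 by simp
  qed
  show "s = s'"
  proof (rule extensionalityI[of _ "{k..<n}"])
    fix i assume "i \<in> {k..<n}"
    then obtain m where "walk N k n s m = (Suc i, s i)" "walk N k n s (Suc m) = (i, s i)"
      using walk_crossing[OF s, of i] by auto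
    thus "s i = s' i" using walk_crossing_unique[of s' m i "s i"] by (simp add: w)
  qed (use s s' in \<open>auto simp: key_seqs_def\<close>)
qed

text \<open>A path is decoded into columns \<open>C\<close> and keys \<open>K\<close>;
  \<open>s i\<close> is the key at the unique time \<open>X i\<close> of passing from column
  \<open>i + 1\<close> to \<open>i\<close>. The walk of \<open>s\<close> then reproduces
  \<open>C\<close> and \<open>K\<close>.\<close>

lemma SE_paths_subset_walk_path: "SE_paths k n \<subseteq> walk_path N k n ` key_seqs N k n"
proof
  fix p assume "p \<in> SE_paths k n"
  hence p0: "p 0 = (n, 0)" and lim: "(\<lambda>m. fst (p m)) \<longlonglongrightarrow> k"
    and steps: "\<And>m. south_step (p (Suc m)) (p m) \<or> east_step (p (Suc m)) (p m)"
    by (auto simp: SE_paths_def)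
  have step: "(\<exists>c'. c = Suc c' \<and> \<kappa> mod N \<le> c' \<and> p (Suc m) = key_vertex N c' \<kappa>) \<or>
      p (Suc m) = key_vertex N c (next_key N c \<kappa>)"
    if p: "p m = key_vertex N c \<kappa>" and c: "c \<le> n" "\<kappa> mod N \<le> c" for m c \<kappa>
    using steps[of m]
  proof
    assume "south_step (p (Suc m)) (p m)"
    then obtain t i j where *: "j \<le> i" "p (Suc m) = lh_vertex t i (j + 1)" "p m = lh_vertex t i j"
      by (auto simp: south_step_def)
    have "t = \<kappa> div N \<and> i = c \<and> j = \<kappa> mod N"
      using lh_vertex_inj[of t i j "\<kappa> div N" c "\<kappa> mod N"] * p c by (simp add: key_vertex_def)
    thus ?thesis using * key_vertex_next_key[of \<kappa> N c] c nN by simp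
  next
    assume "east_step (p (Suc m)) (p m)"
    then obtain t i j where *: "j \<le> i" "p (Suc m) = lh_vertex t i j" "p m = lh_vertex t (i + 1) j"
      by (auto simp: east_step_def)
    have "t = \<kappa> div N \<and> i + 1 = c \<and> j = \<kappa> mod N"
      using lh_vertex_inj[of t "i + 1" j "\<kappa> div N" c "\<kappa> mod N"] * p c by (simp add: key_vertex_def)
    thus ?thesis using * by (auto simp: key_vertex_def)
  qed
  have "\<exists>c \<kappa>. c \<le> n \<and> \<kappa> mod N \<le> c \<and> p m = key_vertex N c \<kappa>" for m
  proof (induction m)
    case 0
    have "p 0 = key_vertex N n 0" by (simp add: p0 key_vertex_def lh_vertex_def)
    thus ?case by (intro exI[of _ n] exI[of _ 0]) simp
  next
    case (Suc m)
    then obtain c \<kappa> where c: "c \<le> n" "\<kappa> mod N \<le> c" "p m = key_vertex N c \<kappa>" by blast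
    show ?case using step[OF c(3,1,2)] c(1) next_key_mod[of N c \<kappa>] Suc_leD by blast
  qed
  then obtain C K where CK: "\<And>m. C m \<le> n" "\<And>m. K m mod N \<le> C m" "\<And>m. p m = key_vertex N (C m) (K m)"
    by metis
  have "C 0 = n \<and> K 0 = 0"
    using key_vertex_inj[of N "C 0" "K 0" n 0] CK(2)[of 0] CK(3)[of 0]
    by (simp add: p0 key_vertex_def lh_vertex_def)
  hence CK0: "C 0 = n" "K 0 = 0" by auto
  have CK_Suc: "(C m = Suc (C (Suc m)) \<and> K (Suc m) = K m) \<or>
      (C (Suc m) = C m \<and> K (Suc m) = next_key N (C m) (K m))" for m
    using step[OF CK(3)[of m] CK(1)[of m] CK(2)[of m]]
  proof
    assume "\<exists>c'. C m = Suc c' \<and> K m mod N \<le> c' \<and> p (Suc m) = key_vertex N c' (K m)"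
    then obtain c' where "C m = Suc c'" "K m mod N \<le> c'" "p (Suc m) = key_vertex N c' (K m)" by blast
    thus ?thesis using key_vertex_inj[of N "C (Suc m)" "K (Suc m)" c' "K m"] CK by simp
  next
    assume "p (Suc m) = key_vertex N (C m) (next_key N (C m) (K m))"
    thus ?thesis
      using key_vertex_inj[of N "C (Suc m)" "K (Suc m)" "C m" "next_key N (C m) (K m)"] CK next_key_mod
      by metis
  qed
  have C_step: "C m \<le> Suc (C (Suc m))" "C (Suc m) \<le> C m" for m
    using CK_Suc[of m] by auto
  have K_step: "K m \<le> K (Suc m)" for m
    using CK_Suc[of m] less_next_key[of N "K m" "C m"] nN by (auto intro: less_imp_le)
  have C_anti: "C m' \<le> C m" if "m \<le> m'" for m m'
    using lift_Suc_antimono_le[of C, OF C_step(2) that] .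
  have K_mono: "K m \<le> K m'" if "m \<le> m'" for m m'
    using lift_Suc_mono_le[of K, OF K_step that] .
  have "fst (p m) = C m" for m by (simp add: CK(3) key_vertex_def lh_vertex_def)
  hence "C \<longlonglongrightarrow> k" using lim by simp
  \<comment> \<open>A convergent sequence of natural numbers is eventually constant.\<close>
  hence "eventually (\<lambda>m. C m = k) sequentially"
    by (simp add: tendsto_discrete)
  then obtain M where M: "\<And>m. M \<le> m \<Longrightarrow> C m = k" by (auto simp: eventually_sequentially)
  have C_ge: "k \<le> C m" for m
    using C_anti[of m "max m M"] M[of "max m M"] by simp
  have "\<exists>m. C m = Suc i \<and> C (Suc m) = i" if "k \<le> i" "i < n" for i
    using unit_descent_crossing[of C M i] C_step CK0 M[of M] that by auto
  then obtain X where X: "\<And>i. k \<le> i \<Longrightarrow> i < n \<Longrightarrow> C (X i) = Suc i \<and> C (Suc (X i)) = i"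
    by metis
  have X_unique: "m = X i" if "C m = Suc i" "C (Suc m) = i" "k \<le> i" "i < n" for m i
    using X[OF that(3,4)] that(1,2) C_anti[of "Suc m" "X i"] C_anti[of "Suc (X i)" m]
    by (metis Suc_n_not_le_n linorder_neqE_nat Suc_leI)
  define s where "s i = (if i \<in> {k..<n} then K (X i) else undefined)" for i
  have K_X: "K (Suc (X i)) = K (X i)" if "k \<le> i" "i < n" for i
    using CK_Suc[of "X i"] X[OF that] by auto
  have s: "s \<in> key_seqs N k n"
    unfolding key_seqs_def
  proof (intro CollectI conjI allI impI ballI)
    show "s \<in> extensional {k..<n}" by (simp add: s_def extensional_def)
  next
    fix i assume "i \<in> {k..<n}"
    thus "s i mod N \<le> i" using CK(2)[of "Suc (X i)"] X[of i] K_X[of i] by (simp add: s_def)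
  next
    fix i assume i: "k \<le> i" "Suc i < n"
    have "X (Suc i) \<le> X i"
    proof (rule ccontr)
      assume "\<not> X (Suc i) \<le> X i"
      hence "C (X (Suc i)) \<le> C (X i)" by (intro C_anti) simp
      thus False using X[of i] X[of "Suc i"] i by simp
    qed
    thus "s (Suc i) \<le> s i" using K_mono i by (simp add: s_def)
  qed
  have walk: "walk N k n s m = (C m, K m)" for m
  proof (induction m)
    case (Suc m)
    show ?case
    proof (cases "C (Suc m) = C m")
      case False
      hence *: "C m = Suc (C (Suc m))" "K (Suc m) = K m" using CK_Suc[of m] by auto
      have "k \<le> C (Suc m)" "C (Suc m) < n" using C_ge CK(1)[of m] * by auto
      moreover from this have "m = X (C (Suc m))" using * X_unique by blast
      ultimately have "s (C (Suc m)) = K m" by (simp add: s_def)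
      thus ?thesis using * \<open>k \<le> C (Suc m)\<close> by (simp add: walk_Suc Suc walk_step_def)
    next
      case True
      hence *: "K (Suc m) = next_key N (C m) (K m)" using CK_Suc[of m] by auto
      \<comment> \<open>The westward move out of this column is still to come and the key grows
        strictly before it, so the walk goes up as the path does.\<close>
      have "s (C m - 1) \<noteq> K m" if "k < C m"
      proof -
        define i where "i = C m - 1"
        have i: "C m = Suc i" "k \<le> i" "i < n" using that CK(1)[of m] by (auto simp: i_def)
        have "Suc m \<le> X i"
        proof (rule ccontr)
          assume "\<not> Suc m \<le> X i"
          hence "C (Suc m) \<le> C (Suc (X i))" by (intro C_anti) simp
          thus False using X[of i] i True by simp
        qed
        hence "K (Suc m) \<le> K (X i)" by (rule K_mono)
        moreover have "K m < K (Suc m)" using less_next_key[of N "K m" "C m"] nN by (simp add: *)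
        ultimately show ?thesis using i by (simp add: s_def)
      qed
      thus ?thesis using * True by (auto simp: walk_Suc Suc walk_step_def)
    qed
  qed (simp add: CK0)
  have "walk_path N k n s = p"
    by (rule ext) (simp add: walk_path_def walk CK(3))
  thus "p \<in> walk_path N k n ` key_seqs N k n" using s by blast
qed

lemma bij_betw_walk_path: "bij_betw (walk_path N k n) (key_seqs N k n) (SE_paths k n)"
  using inj_on_walk_path walk_path_in_SE_paths SE_paths_subset_walk_path
  by (auto simp: bij_betw_def)

text \<open>Each column from \<open>k\<close> to \<open>n - 1\<close> is crossed exactly once, so
  the east steps are indexed by columns.\<close>

lemma path_weight_walk_path:
  assumes s: "s \<in> key_seqs N k n"
  shows "path_weight w (walk_path N k n s) = (\<Prod>i=k..<n. w (s i div N) i (s i mod N))"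
proof -
  have "{(t, i, j). j \<le> i \<and> (\<exists>m. walk_path N k n s (Suc m) = lh_vertex t i j \<and>
      walk_path N k n s m = lh_vertex t (i + 1) j)} = (\<lambda>i. (s i div N, i, s i mod N)) ` {k..<n}"
    (is "?A = ?B")
  proof (intro equalityI subsetI)
    fix x assume "x \<in> ?A"
    then obtain t i j m where x: "x = (t, i, j)" "j \<le> i" "walk_path N k n s (Suc m) = lh_vertex t i j"
      "walk_path N k n s m = lh_vertex t (i + 1) j" by blast
    obtain c \<kappa> where w: "walk N k n s m = (c, \<kappa>)" by fastforce
    obtain c' \<kappa>' where w': "walk N k n s (Suc m) = (c', \<kappa>')" by fastforce
    note inv = walk_invariant[OF s w] and inv' = walk_invariant[OF s w']
    have "t = \<kappa> div N \<and> i + 1 = c \<and> j = \<kappa> mod N"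
      using lh_vertex_inj[of t "i + 1" j "\<kappa> div N" c "\<kappa> mod N"] x inv
      by (simp add: walk_path_def w key_vertex_def)
    moreover have "i = c'"
      using lh_vertex_inj[of t i j "\<kappa>' div N" c' "\<kappa>' mod N"] x inv'
      by (simp add: walk_path_def w' key_vertex_def)
    moreover from calculation have "k \<le> i \<and> s i = \<kappa>"
      using walk_crossing_unique[of s m i \<kappa>] w w' by simp
    ultimately show "x \<in> ?B" using x inv by auto
  next
    fix x assume "x \<in> ?B"
    then obtain i where i: "i \<in> {k..<n}" and x: "x = (s i div N, i, s i mod N)" by blast
    then obtain m where m: "walk N k n s m = (Suc i, s i)" "walk N k n s (Suc m) = (i, s i)"
      using walk_crossing[OF s, of i] by auto
    show "x \<in> ?A" using walk_invariant(3)[OF s m(2)] m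
      by (auto simp: x walk_path_def key_vertex_def intro!: exI[of _ m])
  qed
  moreover have "inj_on (\<lambda>i. (s i div N, i, s i mod N)) {k..<n}" by (auto intro: inj_onI)
  ultimately show ?thesis
    unfolding path_weight_def by (simp add: prod.reindex)
qed

end

section \<open>Layers of the graph\<close>


definition key_seqs_below :: "nat \<Rightarrow> nat \<Rightarrow> nat \<Rightarrow> nat \<Rightarrow> (nat \<Rightarrow> nat) set" where
  "key_seqs_below N k n \<kappa> = {s \<in> key_seqs N k n. \<forall>i\<in>{k..<n}. s i < \<kappa>}"

definition key_weight :: "(nat \<Rightarrow> nat \<Rightarrow> nat \<Rightarrow> 'f::comm_ring_1) \<Rightarrow> nat \<Rightarrow> nat \<Rightarrow> nat \<Rightarrow> (nat \<Rightarrow> nat) \<Rightarrow> 'f" where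
  "key_weight w N k n s = (\<Prod>i=k..<n. w (s i div N) i (s i mod N))"

definition key_sum :: "(nat \<Rightarrow> nat \<Rightarrow> nat \<Rightarrow> 'f::comm_ring_1) \<Rightarrow> nat \<Rightarrow> nat \<Rightarrow> nat \<Rightarrow> nat \<Rightarrow> 'f" where
  "key_sum w N n \<kappa> k = (\<Sum>s\<in>key_seqs_below N k n \<kappa>. key_weight w N k n s)"

lemma finite_key_seqs_below: "finite (key_seqs_below N k n \<kappa>)"
proof (rule finite_subset)
  show "key_seqs_below N k n \<kappa> \<subseteq> {k..<n} \<rightarrow>\<^sub>E {..<\<kappa>}"
    by (auto simp: key_seqs_below_def key_seqs_def PiE_def)
qed (simp add: finite_PiE)

lemma key_sum_refl [simp]: "key_sum w N n \<kappa> n = 1"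
proof -
  have "key_seqs_below N n n \<kappa> = {\<lambda>_. undefined}"
    by (auto simp: key_seqs_below_def key_seqs_def)
  thus ?thesis by (simp add: key_sum_def key_weight_def)
qed

lemma key_sum_0: "k < n \<Longrightarrow> key_sum w N n 0 k = 0"
proof -
  assume "k < n"
  hence "key_seqs_below N k n 0 = {}" by (auto simp: key_seqs_below_def)
  thus ?thesis by (simp add: key_sum_def)
qed

text \<open>The head \<open>s k\<close> is the largest key, so fixing it to \<open>\<kappa>\<close>
  only bounds the tail by \<open>\<kappa>\<close>.\<close>

lemma key_seqs_below_head:
  assumes "k < n" and "\<kappa> mod N \<le> k"
  shows "bij_betw (\<lambda>s. s(k := \<kappa>)) (key_seqs_below N (Suc k) n (Suc \<kappa>))
    {s \<in> key_seqs_below N k n (Suc \<kappa>). s k = \<kappa>}"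
proof (rule bij_betw_byWitness[where f' = "\<lambda>s. s(k := undefined)"])
  show "\<forall>s\<in>key_seqs_below N (Suc k) n (Suc \<kappa>). s(k := \<kappa>, k := undefined) = s"
  proof
    fix s assume "s \<in> key_seqs_below N (Suc k) n (Suc \<kappa>)"
    hence "s k = undefined" by (auto simp: key_seqs_below_def key_seqs_def extensional_def)
    thus "s(k := \<kappa>, k := undefined) = s" by auto
  qed
  show "(\<lambda>s. s(k := \<kappa>)) ` key_seqs_below N (Suc k) n (Suc \<kappa>) \<subseteq>
      {s \<in> key_seqs_below N k n (Suc \<kappa>). s k = \<kappa>}"
    using assms by (auto simp: key_seqs_below_def key_seqs_def extensional_def less_Suc_eq_le)
  show "(\<lambda>s. s(k := undefined)) ` {s \<in> key_seqs_below N k n (Suc \<kappa>). s k = \<kappa>} \<subseteq>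
      key_seqs_below N (Suc k) n (Suc \<kappa>)"
    using assms by (auto simp: key_seqs_below_def key_seqs_def extensional_def)
qed auto

text \<open>Split by whether the largest key \<open>s k\<close> equals \<open>\<kappa>\<close>. If
  so, the tail may use \<open>\<kappa>\<close> again, hence \<open>Suc \<kappa>\<close> in the last
  sum.\<close>

lemma key_sum_Suc:
  assumes "k < n"
  shows "key_sum w N n (Suc \<kappa>) k = key_sum w N n \<kappa> k +
    (if \<kappa> mod N \<le> k then w (\<kappa> div N) k (\<kappa> mod N) * key_sum w N n (Suc \<kappa>) (Suc k) else 0)"
proof -
  let ?H = "{s \<in> key_seqs_below N k n (Suc \<kappa>). s k = \<kappa>}"
  have "s i < \<kappa>" if s: "s \<in> key_seqs_below N k n (Suc \<kappa>)" and "s k \<noteq> \<kappa>" "i \<in> {k..<n}" for s i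
  proof -
    have "s i \<le> s k" using key_seqs_antimono[of s N k n k i] that by (auto simp: key_seqs_below_def)
    moreover have "s k < Suc \<kappa>" using s assms by (auto simp: key_seqs_below_def)
    ultimately show ?thesis using that by simp
  qed
  hence split: "key_seqs_below N k n (Suc \<kappa>) = key_seqs_below N k n \<kappa> \<union> ?H"
    using assms by (fastforce simp: key_seqs_below_def)
  have disj: "key_seqs_below N k n \<kappa> \<inter> ?H = {}"
    using assms by (auto simp: key_seqs_below_def)
  have "key_sum w N n (Suc \<kappa>) k = key_sum w N n \<kappa> k + (\<Sum>s\<in>?H. key_weight w N k n s)"
    unfolding key_sum_def
    by (subst split, rule sum.union_disjoint)
      (use finite_key_seqs_below[of N k n] disj in auto)
  also have "(\<Sum>s\<in>?H. key_weight w N k n s) =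
    (if \<kappa> mod N \<le> k then w (\<kappa> div N) k (\<kappa> mod N) * key_sum w N n (Suc \<kappa>) (Suc k) else 0)"
  proof (cases "\<kappa> mod N \<le> k")
    case True
    have "(\<Sum>s\<in>?H. key_weight w N k n s) =
        (\<Sum>s\<in>key_seqs_below N (Suc k) n (Suc \<kappa>). key_weight w N k n (s(k := \<kappa>)))"
      by (rule sum.reindex_bij_betw[OF key_seqs_below_head[OF assms True], symmetric])
    also have "\<dots> = (\<Sum>s\<in>key_seqs_below N (Suc k) n (Suc \<kappa>).
        w (\<kappa> div N) k (\<kappa> mod N) * key_weight w N (Suc k) n s)"
      using assms by (intro sum.cong refl) (simp add: key_weight_def prod.atLeast_Suc_lessThan)
    finally show ?thesis using True by (simp add: key_sum_def sum_distrib_left)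
  next
    case False
    hence "?H = {}" using assms by (auto simp: key_seqs_below_def key_seqs_def)
    thus ?thesis using False by (simp only: sum.empty if_False)
  qed
  finally show ?thesis .
qed

text \<open>By monotonicity the columns crossed inside layer \<open>t\<close> are
  \<open>k, ..., m - 1\<close>, at weakly decreasing positions, whence \<open>hsym\<close>. Formally
  \<open>key_sum_Suc\<close> matches its recursion; \<open>J \<le> Suc k\<close> keeps all positions
  legal in column \<open>k\<close>.\<close>

lemma key_sum_partial_layer:
  assumes w: "\<And>i j. j \<le> i \<Longrightarrow> w t i j = u i * x j"
    and "k \<le> n" "n < N" "J \<le> Suc k"
  shows "key_sum w N n (t * N + J) k =
    (\<Sum>m=k..n. key_sum w N n (t * N) m * ((\<Prod>i=k..<m. u i) * hsym x J (m - k)))"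
  using assms(2,4)
proof (induction k arbitrary: J rule: inc_induct)
  case (step k)
  note outer = step.IH
  have hd: "(\<Sum>m=k..n. f m) = f k + (\<Sum>m=Suc k..n. f m)" for f :: "nat \<Rightarrow> 'a"
    using step.hyps by (simp add: sum.atLeast_Suc_atMost)
  have tl: "(\<Prod>i=k..<m. u i) = u k * (\<Prod>i=Suc k..<m. u i)" "m - k = Suc (m - Suc k)"
    if "m \<in> {Suc k..n}" for m
    using that by (auto simp: prod.atLeast_Suc_lessThan)
  from step.prems show ?case
  proof (induction J)
    case 0
    have "(\<Sum>m=Suc k..n. key_sum w N n (t * N) m * ((\<Prod>i=k..<m. u i) * hsym x 0 (m - k))) = 0"
      by (intro sum.neutral) (simp add: tl)
    thus ?case by (simp add: hd)
  next
    case (Suc J)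
    have J: "J \<le> k" "J < N" using Suc.prems step.hyps assms(3) by auto
    have "key_sum w N n (t * N + Suc J) k =
        key_sum w N n (t * N + J) k + u k * x J * key_sum w N n (t * N + Suc J) (Suc k)"
      using key_sum_Suc[OF step.hyps(2), of w N "t * N + J"] J w[of J k] by simp
    also have "\<dots> = key_sum w N n (t * N) k + (\<Sum>m=Suc k..n. key_sum w N n (t * N) m *
          ((\<Prod>i=k..<m. u i) * hsym x J (m - k))) +
        (\<Sum>m=Suc k..n. u k * x J * (key_sum w N n (t * N) m *
          ((\<Prod>i=Suc k..<m. u i) * hsym x (Suc J) (m - Suc k))))"
      using Suc outer[of "Suc J"] by (simp add: hd sum_distrib_left del: hsym.simps(3))
    also have "\<dots> = key_sum w N n (t * N) k + (\<Sum>m=Suc k..n. key_sum w N n (t * N) m *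
          ((\<Prod>i=k..<m. u i) * hsym x (Suc J) (m - k)))"
      unfolding add.assoc sum.distrib[symmetric]
      by (intro arg_cong2[of _ _ _ _ "(+)"] sum.cong refl) (simp add: tl algebra_simps)
    finally show ?case by (simp add: hd)
  qed
qed simp

lemma key_sum_layer:
  assumes w: "\<And>i j. j \<le> i \<Longrightarrow> w t i j = u i * x j"
    and "k \<le> n" "n < N"
  shows "key_sum w N n (Suc t * N) k =
    (\<Sum>m=k..n. key_sum w N n (t * N) m * ((\<Prod>i=k..<m. u i) * hsym x (Suc k) (m - k)))"
proof -
  \<comment> \<open>Positions beyond \<open>k\<close> are not legal in column \<open>k\<close>, so
    they contribute nothing.\<close>
  have "key_sum w N n (t * N + J) k = key_sum w N n (t * N + Suc k) k" if "Suc k \<le> J" "J \<le> N" for J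
    using that
  proof (induction J rule: dec_induct)
    case (step J)
    show ?case
    proof (cases "k = n")
      case False
      thus ?thesis using key_sum_Suc[of k n w N "t * N + J"] step assms(2) by simp
    qed simp
  qed simp
  from this[of N] show ?thesis
    using key_sum_partial_layer[where w=w and t=t and u=u and x=x and J="Suc k", OF w assms(2,3) order.refl] assms(2,3) by (simp add: add.commute)
qed

text \<open>The sum over paths whose east steps all lie in layers below \<open>t\<close>, with the
  key base \<open>N = Suc n\<close>. The value 0 for \<open>k > n\<close> makes it a triangular
  matrix.\<close>

definition trunc_sum :: "(nat \<Rightarrow> nat \<Rightarrow> nat \<Rightarrow> 'f::comm_ring_1) \<Rightarrow> nat \<Rightarrow> nat \<Rightarrow> nat \<Rightarrow> 'f" where
  "trunc_sum w t n k = (if k \<le> n then key_sum w (Suc n) n (t * Suc n) k else 0)"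

lemma trunc_sum_refl [simp]: "trunc_sum w t n n = 1"
  by (simp add: trunc_sum_def)

lemma trunc_sum_Suc:
  assumes "\<And>i j. j \<le> i \<Longrightarrow> w t i j = u i * x j"
  shows "trunc_sum w (Suc t) =
    mat_mult (trunc_sum w t) (mat_scale u (\<lambda>n k. hsym x (Suc k) (n - k)))"
proof (intro ext)
  fix n k
  show "trunc_sum w (Suc t) n k =
      mat_mult (trunc_sum w t) (mat_scale u (\<lambda>n k. hsym x (Suc k) (n - k))) n k"
    using key_sum_layer[where w=w and t=t and u=u and x=x and k=k and n=n and N="Suc n", OF assms]
    by (auto simp: trunc_sum_def mat_mult_def mat_scale_def mult_ac simp del: mult_Suc mult_Suc_right hsym.simps)
qed

section \<open>The eight layers of a period\<close>

context aw_params
begin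

abbreviation "W \<equiv> aw_weight a b c d q"

text \<open>The tail weight is \<open>layer t i * q ^ j\<close>, so this is its column
  factor.\<close>

definition layer :: "nat \<Rightarrow> nat \<Rightarrow> 'f" where
  "layer t i = aw_weight_tail a b c d q t i 0"

lemma trunc_sum_1: "trunc_sum W 1 n k = (if k \<le> n then hsym node (Suc k) (n - k) else 0)"
proof -
  have 0: "trunc_sum W 0 n m = (if m = n then 1 else 0)" for m
    by (auto simp: trunc_sum_def key_sum_0)
  have "trunc_sum W (Suc 0) = mat_mult (trunc_sum W 0) (mat_scale (\<lambda>_. 1) (\<lambda>n k. hsym node (Suc k) (n - k)))"
    by (rule trunc_sum_Suc) (simp add: aw_weight_def node_def)
  hence "trunc_sum W 1 n k = (\<Sum>m=k..n. (if m = n then 1 else 0) * hsym node (Suc k) (m - k))"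
    by (simp only: One_nat_def mat_mult_def mat_scale_def 0) simp
  also have "\<dots> = (\<Sum>m=k..n. if m = n then hsym node (Suc k) (m - k) else 0)"
    by (intro sum.cong refl) auto
  finally show ?thesis by simp
qed

lemma trunc_sum_Suc_tail: "trunc_sum W (Suc (Suc t)) = mat_mult (trunc_sum W (Suc t)) (mat_scale (layer t) (qbin q))"
proof -
  have "trunc_sum W (Suc (Suc t)) = mat_mult (trunc_sum W (Suc t))
      (mat_scale (layer t) (\<lambda>n k. hsym (\<lambda>j. q ^ j) (Suc k) (n - k)))"
    by (rule trunc_sum_Suc) (simp add: aw_weight_def layer_def aw_weight_tail_def)
  also have "\<dots> = mat_mult (trunc_sum W (Suc t)) (mat_scale (layer t) (qbin q))"
    by (intro ext) (auto simp: mat_mult_def mat_scale_def hsym_power simp del: hsym.simps intro!: sum.cong)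
  finally show ?thesis .
qed

abbreviation "ypow M i \<equiv> (a * b * c * d * q ^ (2 * i)) ^ M"

text \<open>Each layer after the first of a period is an earlier one times
  \<open>- x * q ^ i\<close> with \<open>x\<close> among \<open>ad\<close>, \<open>ac\<close>,
  \<open>ab\<close>, the shape required by \<open>mat_scale_qbin_mult\<close>.\<close>

lemma layer_8:
  "layer (8 * M) = (\<lambda>i. ypow M i * \<omega> i)"
  "layer (8 * M + 1) = (\<lambda>i. - (a * d) * q ^ i * layer (8 * M) i)"
  "layer (8 * M + 2) = (\<lambda>i. - (a * c) * q ^ i * layer (8 * M) i)"
  "layer (8 * M + 3) = (\<lambda>i. - (a * d) * q ^ i * layer (8 * M + 2) i)"
  "layer (8 * M + 4) = (\<lambda>i. - (a * b) * q ^ i * layer (8 * M) i)"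
  "layer (8 * M + 5) = (\<lambda>i. - (a * d) * q ^ i * layer (8 * M + 4) i)"
  "layer (8 * M + 6) = (\<lambda>i. - (a * c) * q ^ i * layer (8 * M + 4) i)"
  "layer (8 * M + 7) = (\<lambda>i. - (a * d) * q ^ i * layer (8 * M + 6) i)"
proof -
  have dm: "(8 * M + r) div 8 = M" "(8 * M + r) mod 8 = r" if "r < 8" for r
    using that by auto
  have L: "layer (8 * M + r) i = 1 / 2 * ypow M i *
      ([- (inverse a * inverse (q ^ i)), d, c, - (a * c * d * q ^ i), b, - (a * b * d * q ^ i),
        - (a * b * c * q ^ i), a\<^sup>2 * b * c * d * q ^ (2 * i)] ! r)" if "r < 8" for r i
    by (simp only: layer_def aw_weight_tail_def dm[OF that] power_0 mult_1_right)
  have e: "a\<^sup>2 * b * c * d * q ^ (2 * i) = a * d * (q ^ i * (a * b * c * q ^ i))" for i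
    by (simp add: power2_eq_square mult_2 power_add)
  have L0: "layer (8 * M) i = 1 / 2 * ypow M i * - (inverse a * inverse (q ^ i))" for i
    using L[of 0 i] by simp
  have inv: "a * (q ^ i * (inverse a * inverse (q ^ i))) = 1" for i
    using a_nonzero q_nonzero by (simp add: field_simps)
  show "layer (8 * M) = (\<lambda>i. ypow M i * \<omega> i)"
    by (rule ext) (simp add: L0 \<omega>_def)
  show "layer (8 * M + 1) = (\<lambda>i. - (a * d) * q ^ i * layer (8 * M) i)"
    "layer (8 * M + 2) = (\<lambda>i. - (a * c) * q ^ i * layer (8 * M) i)"
    "layer (8 * M + 4) = (\<lambda>i. - (a * b) * q ^ i * layer (8 * M) i)"
    by (simp_all only: fun_eq_iff L L0) (simp_all add: inv)
  show "layer (8 * M + 3) = (\<lambda>i. - (a * d) * q ^ i * layer (8 * M + 2) i)"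
    "layer (8 * M + 5) = (\<lambda>i. - (a * d) * q ^ i * layer (8 * M + 4) i)"
    "layer (8 * M + 6) = (\<lambda>i. - (a * c) * q ^ i * layer (8 * M + 4) i)"
    "layer (8 * M + 7) = (\<lambda>i. - (a * d) * q ^ i * layer (8 * M + 6) i)"
    by (simp_all only: fun_eq_iff L e) simp_all
qed

text \<open>Layers merge along a binary tree: neighbours with \<open>x = ad\<close>, the resulting
  pairs with \<open>x = ac\<close>, the two halves with \<open>x = ab\<close>. This yields the three
  factors of \<open>\<rho>\<close>.\<close>

lemma eight_layers:
  "trunc_sum W (8 * M + 9) = mat_mult (trunc_sum W (8 * M + 1))
    (mat_scale (\<lambda>i. ypow M i * (\<omega> i * \<rho> i)) (qbin q))"
proof -
  let ?L = "\<lambda>r. mat_scale (layer (8 * M + r)) (qbin q)"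
  have L01: "mat_mult (?L 0) (?L 1) = mat_scale (\<lambda>i. (1 - a * d * q ^ i) * layer (8 * M) i) (qbin q)"
    unfolding layer_8(2) add_0_right by (rule mat_scale_qbin_mult)
  have L23: "mat_mult (?L 2) (?L 3) = mat_scale (\<lambda>i. (1 - a * d * q ^ i) * layer (8 * M + 2) i) (qbin q)"
    unfolding layer_8(4) by (rule mat_scale_qbin_mult)
  have L45: "mat_mult (?L 4) (?L 5) = mat_scale (\<lambda>i. (1 - a * d * q ^ i) * layer (8 * M + 4) i) (qbin q)"
    unfolding layer_8(6) by (rule mat_scale_qbin_mult)
  have L67: "mat_mult (?L 6) (?L 7) = mat_scale (\<lambda>i. (1 - a * d * q ^ i) * layer (8 * M + 6) i) (qbin q)"
    unfolding layer_8(8) by (rule mat_scale_qbin_mult)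
  have L03: "mat_mult (mat_mult (?L 0) (?L 1)) (mat_mult (?L 2) (?L 3)) =
      mat_scale (\<lambda>i. (1 - a * c * q ^ i) * ((1 - a * d * q ^ i) * layer (8 * M) i)) (qbin q)"
    unfolding L01 L23 unfolding layer_8(3) using mat_scale_qbin_mult[of "\<lambda>i. (1 - a * d * q ^ i) * layer (8 * M) i" "a * c"]
    by (simp only: mult_ac)
  have L47: "mat_mult (mat_mult (?L 4) (?L 5)) (mat_mult (?L 6) (?L 7)) =
      mat_scale (\<lambda>i. (1 - a * c * q ^ i) * ((1 - a * d * q ^ i) * layer (8 * M + 4) i)) (qbin q)"
    unfolding L45 L67 unfolding layer_8(7) using mat_scale_qbin_mult[of "\<lambda>i. (1 - a * d * q ^ i) * layer (8 * M + 4) i" "a * c"]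
    by (simp only: mult_ac)
  have L07: "mat_mult (mat_mult (mat_mult (?L 0) (?L 1)) (mat_mult (?L 2) (?L 3)))
      (mat_mult (mat_mult (?L 4) (?L 5)) (mat_mult (?L 6) (?L 7))) =
      mat_scale (\<lambda>i. (1 - a * b * q ^ i) * ((1 - a * c * q ^ i) * ((1 - a * d * q ^ i) * layer (8 * M) i))) (qbin q)"
    unfolding L03 L47 unfolding layer_8(5) using mat_scale_qbin_mult[of "\<lambda>i. (1 - a * c * q ^ i) * ((1 - a * d * q ^ i) * layer (8 * M) i)" "a * b"]
    by (simp only: mult_ac)
  define T where "T r = trunc_sum W (8 * M + Suc r)" for r
  have step: "T (r + 1) = mat_mult (T r) (?L r)" for r
    using trunc_sum_Suc_tail[of "8 * M + r"] by (simp add: T_def)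
  have "T 8 = mat_mult (T 0)
      (mat_mult (mat_mult (mat_mult (?L 0) (?L 1)) (mat_mult (?L 2) (?L 3)))
      (mat_mult (mat_mult (?L 4) (?L 5)) (mat_mult (?L 6) (?L 7))))"
  proof -
    have "T 1 = mat_mult (T 0) (?L 0)" using step[of 0] by simp
    moreover have "T 2 = mat_mult (T 1) (?L 1)" using step[of 1] unfolding one_add_one .
    moreover have "T 3 = mat_mult (T 2) (?L 2)" using step[of 2] by simp
    moreover have "T 4 = mat_mult (T 3) (?L 3)" using step[of 3] by simp
    moreover have "T 5 = mat_mult (T 4) (?L 4)" using step[of 4] by simp
    moreover have "T 6 = mat_mult (T 5) (?L 5)" using step[of 5] by simp
    moreover have "T 7 = mat_mult (T 6) (?L 6)" using step[of 6] by simp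
    moreover have "T 8 = mat_mult (T 7) (?L 7)" using step[of 7] by simp
    ultimately show ?thesis by (simp only: mat_mult_assoc)
  qed
  thus ?thesis unfolding L07 layer_8(1) by (simp add: T_def \<rho>_def mult_ac)
qed

abbreviation "aw_conn \<equiv> conn (\<lambda>i. \<omega> i * \<rho> i)"

text \<open>By \<open>conn_rec\<close> the scaled \<open>aw_conn\<close> splits off the matrix of
  one period, which \<open>eight_layers\<close> absorbs into the truncated sum; so the left side is
  independent of \<open>M\<close>.\<close>

lemma trunc_sum_conn:
  "mat_mult (trunc_sum W (8 * M + 1)) (mat_scale (ypow M) aw_conn) = mat_mult (trunc_sum W 1) aw_conn"
proof (induction M)
  case 0
  show ?case by (simp add: mat_scale_def[abs_def])
next
  case (Suc M)
  have rec: "mat_mult (mat_scale (\<lambda>i. \<omega> i * \<rho> i) (qbin q)) (mat_scale (\<lambda>i. a * b * c * d * q ^ (2 * i)) aw_conn) = aw_conn"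
  proof (intro ext)
    fix n k
    show "mat_mult (mat_scale (\<lambda>i. \<omega> i * \<rho> i) (qbin q)) (mat_scale (\<lambda>i. a * b * c * d * q ^ (2 * i)) aw_conn) n k = aw_conn n k"
    proof (cases "k \<le> n")
      case False
      thus ?thesis by (simp add: mat_mult_def conn_def mat_scale_def)
    qed (simp add: conn_rec)
  qed
  have "mat_scale (ypow (Suc M)) aw_conn = mat_scale (ypow M) (mat_scale (\<lambda>i. a * b * c * d * q ^ (2 * i)) aw_conn)"
    by (simp add: mat_scale_scale mult_ac)
  moreover have "mat_scale (\<lambda>i. ypow M i * (\<omega> i * \<rho> i)) (qbin q) =
      mat_scale (ypow M) (mat_scale (\<lambda>i. \<omega> i * \<rho> i) (qbin q))"
    by (simp add: mat_scale_scale)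
  ultimately have "mat_mult (trunc_sum W (8 * M + 9)) (mat_scale (ypow (Suc M)) aw_conn) =
      mat_mult (trunc_sum W (8 * M + 1)) (mat_scale (ypow M) aw_conn)"
    by (simp add: eight_layers mat_mult_assoc rec flip: mat_scale_mult)
  thus ?case using Suc.IH by (simp add: add.commute)
qed

text \<open>As the diagonal of \<open>aw_conn\<close> is 1, the summand \<open>m = k\<close> of the
  product is the truncated sum itself. Every other summand carries a factor
  \<open>ypow M\<close>.\<close>

lemma aw_mixed_moment_minus_trunc_sum:
  assumes "k \<le> n"
  shows "aw_mixed_moment a b c d q n k - trunc_sum W (8 * M + 1) n k =
    (\<Sum>m=Suc k..n. trunc_sum W (8 * M + 1) n m * mat_scale (ypow M) aw_conn m k)"
proof -
  have "aw_mixed_moment a b c d q n k = mat_mult (trunc_sum W 1) aw_conn n k"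
    unfolding aw_mixed_moment_eq[OF assms] mat_mult_def
    by (intro sum.cong refl) (simp add: trunc_sum_1 del: hsym.simps One_nat_def)
  also have "\<dots> = mat_mult (trunc_sum W (8 * M + 1)) (mat_scale (ypow M) aw_conn) n k"
    by (simp only: trunc_sum_conn)
  also have "\<dots> = trunc_sum W (8 * M + 1) n k * mat_scale (ypow M) aw_conn k k +
      (\<Sum>m=Suc k..n. trunc_sum W (8 * M + 1) n m * mat_scale (ypow M) aw_conn m k)"
    unfolding mat_mult_def using assms by (rule sum.atLeast_Suc_atMost)
  also have "mat_scale (ypow M) aw_conn k k = 1"
    by (simp add: mat_scale_def conn_def)
  finally show ?thesis by simp
qed

end

section \<open>Formal convergence\<close>


lemma to_fract_power: "to_fract (x ^ n) = to_fract x ^ n"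
  by (induction n) simp_all

lemma to_fract_prod: "to_fract (prod f A) = (\<Prod>x\<in>A. to_fract (f x))"
  by (induction A rule: infinite_finite_induct) simp_all

text \<open>Membership in the power series ring and divisibility in one notion; in the application
  the outer variable is \<open>d\<close>.\<close>

definition X_multiple :: "nat \<Rightarrow> 'r::idom fps fract \<Rightarrow> bool" where
  "X_multiple M x \<longleftrightarrow> (\<exists>r. x = to_fract (fps_X ^ M * r))"

abbreviation is_fps :: "'r::idom fps fract \<Rightarrow> bool" where
  "is_fps \<equiv> X_multiple 0"

lemma X_multipleI: "x = to_fract (fps_X ^ M * r) \<Longrightarrow> X_multiple M x"
  by (auto simp: X_multiple_def)

lemma is_fps_to_fract [simp]: "is_fps (to_fract r)"
  by (rule X_multipleI[of _ _ r]) simp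

lemma is_fps_0 [simp]: "is_fps 0" and is_fps_1 [simp]: "is_fps 1"
  using is_fps_to_fract[of 0] is_fps_to_fract[of 1] by (simp_all only: to_fract_0 to_fract_1)

lemma X_multiple_0: "X_multiple M 0"
  by (rule X_multipleI[of _ _ 0]) simp

lemma X_multiple_add: "X_multiple M x \<Longrightarrow> X_multiple M y \<Longrightarrow> X_multiple M (x + y)"
  unfolding X_multiple_def by (metis distrib_left to_fract_add)

lemma X_multiple_diff: "X_multiple M x \<Longrightarrow> X_multiple M y \<Longrightarrow> X_multiple M (x - y)"
  unfolding X_multiple_def by (metis right_diff_distrib to_fract_diff)

lemma X_multiple_uminus: "X_multiple M x \<Longrightarrow> X_multiple M (- x)"
  unfolding X_multiple_def by (metis mult_minus_right to_fract_uminus)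

lemma X_multiple_mult: "X_multiple M x \<Longrightarrow> X_multiple M' y \<Longrightarrow> X_multiple (M + M') (x * y)"
proof -
  assume "X_multiple M x" "X_multiple M' y"
  then obtain r r' where "x = to_fract (fps_X ^ M * r)" "y = to_fract (fps_X ^ M' * r')"
    by (auto simp: X_multiple_def)
  thus ?thesis
    by (intro X_multipleI[of _ _ "r * r'"]) (simp add: power_add mult_ac flip: to_fract_mult)
qed

lemma X_multiple_mult_left: "is_fps x \<Longrightarrow> X_multiple M y \<Longrightarrow> X_multiple M (x * y)"
  using X_multiple_mult[of 0 x M y] by simp

lemma X_multiple_mult_right: "X_multiple M x \<Longrightarrow> is_fps y \<Longrightarrow> X_multiple M (x * y)"
  using X_multiple_mult[of M x 0 y] by simp

lemma X_multiple_sum: "(\<And>x. x \<in> A \<Longrightarrow> X_multiple M (f x)) \<Longrightarrow> X_multiple M (sum f A)"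
  by (induction A rule: infinite_finite_induct) (auto intro: X_multiple_add X_multiple_0)

lemma is_fps_prod: "(\<And>x. x \<in> A \<Longrightarrow> is_fps (f x)) \<Longrightarrow> is_fps (prod f A)"
  by (induction A rule: infinite_finite_induct) (auto intro: X_multiple_mult_left)

lemma is_fps_power: "is_fps x \<Longrightarrow> is_fps (x ^ n)"
  by (induction n) (auto intro: X_multiple_mult_left)

lemma X_multiple_power: "X_multiple 1 x \<Longrightarrow> X_multiple n (x ^ n)"
proof (induction n)
  case (Suc n)
  thus ?case using X_multiple_mult[of 1 x n "x ^ n"] by simp
qed simp

lemma X_multiple_is_fps: "X_multiple M x \<Longrightarrow> is_fps x"
  by (auto simp: X_multiple_def simp del: to_fract_mult)

lemma X_multiple_mono: "X_multiple M x \<Longrightarrow> M' \<le> M \<Longrightarrow> X_multiple M' x"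
proof -
  assume "X_multiple M x" "M' \<le> M"
  then obtain r where r: "x = to_fract (fps_X ^ M * r)" by (auto simp: X_multiple_def)
  have "fps_X ^ M * r = fps_X ^ M' * (fps_X ^ (M - M') * r)"
    using \<open>M' \<le> M\<close> by (metis le_add_diff_inverse mult.assoc power_add)
  thus ?thesis using r by (metis X_multipleI)
qed

lemma X_multiple_prod:
  assumes "\<And>i. i \<in> A \<Longrightarrow> is_fps (f i)" and "finite A" "i \<in> A" "X_multiple M (f i)"
  shows "X_multiple M (prod f A)"
  unfolding prod.remove[OF assms(2,3)] using assms
  by (intro X_multiple_mult_right is_fps_prod) auto

lemma X_multiple_to_fract_iff: "X_multiple M (to_fract r) \<longleftrightarrow> (\<forall>l<M. fps_nth r l = 0)"
proof
  assume "X_multiple M (to_fract r)"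
  then obtain r' where "r = fps_X ^ M * r'" by (auto simp: X_multiple_def simp del: to_fract_mult)
  thus "\<forall>l<M. fps_nth r l = 0" by (simp add: fps_X_power_mult_nth)
next
  assume "\<forall>l<M. fps_nth r l = 0"
  hence "r = fps_X ^ M * fps_shift M r" by (simp add: fps_eq_iff fps_X_power_mult_nth)
  thus "X_multiple M (to_fract r)" by (metis X_multipleI)
qed

text \<open>All coefficients vanish, that is, the filtration by powers of the variable is separated.
  The final equality rests on this.\<close>

lemma X_multiple_all_imp_0:
  assumes "\<And>M. X_multiple M x"
  shows "x = 0"
proof -
  obtain r where r: "x = to_fract r" using assms[of 0] by (auto simp: X_multiple_def)
  have "fps_nth r l = 0" for l using assms[of "Suc l"] by (simp add: r X_multiple_to_fract_iff)
  thus ?thesis by (simp add: r fps_eq_iff)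
qed

lemma is_fps_hsym: "(\<And>j. is_fps (x j)) \<Longrightarrow> is_fps (hsym x J N)"
  by (induction x J N rule: hsym.induct) (auto intro: X_multiple_add X_multiple_mult_left)

section \<open>The indeterminates inside the power series ring\<close>

abbreviation scalar_fract :: "laurent \<Rightarrow> aw_field" where
  "scalar_fract x \<equiv> to_fract (scalar3 x)"

lemma scalar3_mult: "scalar3 (x * y) = scalar3 x * scalar3 (y :: 'k :: comm_ring_1)"
  and scalar3_1: "scalar3 (1 :: 'k) = 1"
  and scalar3_add: "scalar3 (x + y) = scalar3 x + scalar3 y"
  by (simp_all add: scalar3_def)

lemma coeff3_0_mult: "coeff3 (r * r') 0 0 0 = coeff3 r 0 0 0 * coeff3 (r' :: 'k :: comm_ring_1 pow3) 0 0 0"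
  and coeff3_0_1: "coeff3 (1 :: 'k pow3) 0 0 0 = 1"
  by (simp_all add: coeff3_def)

lemma single_power: "Poly_Mapping.single (0 :: int) x ^ n = Poly_Mapping.single 0 ((x :: 'k :: comm_semiring_1) ^ n)"
  by (induction n) (simp_all add: mult_single)

text \<open>These explicit inverses show that division by \<open>q\<close>, \<open>a\<close> and 2
  does not lead out of the power series ring.\<close>

lemma indet_inverse:
  "inverse indet_q = scalar_fract (Poly_Mapping.single 0 (inverse (to_fract [:0, 1:])))" (is ?q)
  "inverse indet_a = scalar_fract (Poly_Mapping.single (-1) 1)" (is ?a)
  "inverse 2 = scalar_fract (Poly_Mapping.single 0 (1 / 2))" (is ?two)
proof -
  show ?q unfolding indet_q_def
    by (intro inverse_unique) (simp add: mult_single scalar3_1 flip: to_fract_mult scalar3_mult)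
  show ?a unfolding indet_a_def
    by (intro inverse_unique) (simp add: mult_single scalar3_1 flip: to_fract_mult scalar3_mult)
  have "(2 :: aw_field) = scalar_fract 2"
    using to_fract_add[of "1 :: laurent pow3" 1] scalar3_add[of "1 :: laurent" 1]
    by (simp add: scalar3_1 del: to_fract_add)
  moreover have "scalar_fract 2 * scalar_fract (Poly_Mapping.single 0 (1 / 2)) = 1"
    using mult_single[of "0 :: int" "2 :: ratq" "0 :: int" "1 / 2"]
    by (simp add: scalar3_1 flip: to_fract_mult scalar3_mult)
  ultimately show ?two by (intro inverse_unique) simp
qed

lemma indet_coeff3_0:
  obtains A B C D Q where
    "indet_a = to_fract A" "indet_b = to_fract B" "indet_c = to_fract C" "indet_d = to_fract D"
    "indet_q = to_fract Q" "coeff3 B 0 0 0 = 0" "coeff3 C 0 0 0 = 0" "coeff3 D 0 0 0 = 0"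
    "coeff3 Q 0 0 0 = Poly_Mapping.single 0 (to_fract [:0, 1:])"
  using that[OF indet_a_def indet_b_def indet_c_def indet_d_def indet_q_def]
  by (simp add: coeff3_def scalar3_def)

interpretation indet: aw_params indet_a indet_b indet_c indet_d indet_q
proof -
  obtain A B C D Q where *:
    "indet_a = to_fract A" "indet_b = to_fract B" "indet_c = to_fract C" "indet_d = to_fract D"
    "indet_q = to_fract Q" and **: "coeff3 B 0 0 0 = 0" "coeff3 C 0 0 0 = 0" "coeff3 D 0 0 0 = 0"
    "coeff3 Q 0 0 0 = Poly_Mapping.single 0 (to_fract [:0, 1:])"
    by (rule indet_coeff3_0)
  \<comment> \<open>Constant coefficients decide all conditions of the form
    \<open>\<noteq> 1\<close>: they are 0 for products containing \<open>b\<close>, \<open>c\<close>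
    or \<open>d\<close>, and a nonconstant polynomial for positive powers of
    \<open>q\<close>.\<close>
  have neq1: "to_fract r \<noteq> (1 :: aw_field)" if "coeff3 r 0 0 0 \<noteq> 1" for r
    using that coeff3_0_1 by (metis to_fract_1 to_fract_eq_iff)
  have coeff3_power: "coeff3 (r ^ n) 0 0 0 = coeff3 r 0 0 0 ^ n" for r :: "laurent pow3" and n
    by (induction n) (simp_all add: coeff3_0_mult coeff3_0_1)
  have single_nz: "Poly_Mapping.single i x \<noteq> 0" if "x \<noteq> 0" for i :: int and x :: ratq
    using that by (metis lookup_single_eq lookup_zero)
  show "aw_params indet_a indet_b indet_c indet_d indet_q"
  proof
    show "indet_q \<noteq> 0" "indet_a \<noteq> 0"
      unfolding indet_q_def indet_a_def by (simp_all add: scalar3_def single_nz)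
    show "indet_q ^ n \<noteq> 1" if "0 < n" for n
      unfolding * to_fract_power[symmetric]
    proof (rule neq1)
      have "[:0, 1:] ^ n \<noteq> (1 :: rat poly)"
        using that degree_power_eq[of "[:0, 1 :: rat:]" n] by auto
      hence "to_fract ([:0, 1:] ^ n :: rat poly) \<noteq> 1"
        using to_fract_eq_iff[of "[:0, 1:] ^ n :: rat poly" 1] by (simp del: to_fract_eq_iff)
      hence "Poly_Mapping.single (0 :: int) (to_fract ([:0, 1:] ^ n :: rat poly)) \<noteq> Poly_Mapping.single 0 1"
        by (metis lookup_single_eq)
      thus "coeff3 (Q ^ n) 0 0 0 \<noteq> 1"
        by (simp add: coeff3_power ** single_power to_fract_power)
    qed
    show "indet_a * indet_b * indet_c * indet_d * indet_q ^ n \<noteq> 1"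
      "indet_a * indet_b * indet_q ^ n \<noteq> 1" "indet_a * indet_c * indet_q ^ n \<noteq> 1"
      "indet_a * indet_d * indet_q ^ n \<noteq> 1" for n
      unfolding * to_fract_power[symmetric] to_fract_mult[symmetric]
      by (rule neq1, simp add: coeff3_0_mult **)+
    show "(2 :: aw_field) \<noteq> 0"
    proof
      assume "(2 :: aw_field) = 0"
      hence "inverse (2 :: aw_field) = 0" by simp
      thus False unfolding indet_inverse by (simp add: scalar3_def single_nz)
    qed
  qed
qed

lemma is_fps_indet:
  "is_fps indet_a" "is_fps indet_b" "is_fps indet_c" "is_fps indet_q"
  "is_fps (inverse indet_a)" "is_fps (inverse indet_q)" "is_fps (inverse 2 :: aw_field)"
  unfolding indet_inverse by (simp_all add: indet_a_def indet_b_def indet_c_def indet_q_def)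

lemma X_multiple_indet_d: "X_multiple 1 indet_d"
  by (rule X_multipleI[of _ _ 1]) (simp add: indet_d_def)

lemmas is_fps_intros = is_fps_indet X_multiple_is_fps[OF X_multiple_indet_d] X_multiple_add X_multiple_diff
  X_multiple_uminus X_multiple_mult_left is_fps_power is_fps_prod is_fps_1

abbreviation indet_weight :: "nat \<Rightarrow> nat \<Rightarrow> nat \<Rightarrow> aw_field" where
  "indet_weight \<equiv> aw_weight indet_a indet_b indet_c indet_d indet_q"

lemma X_multiple_ypow:
  "X_multiple M ((indet_a * indet_b * indet_c * indet_d * indet_q ^ i) ^ M)"
  by (intro X_multiple_power X_multiple_mult_right[OF X_multiple_mult_left] X_multiple_indet_d is_fps_intros)

lemma is_fps_inverse_power: "is_fps (inverse (indet_q ^ i))"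
  unfolding power_inverse[symmetric] by (intro is_fps_intros)

text \<open>The period number \<open>(t - 1) div 8\<close> is the exponent of
  \<open>abcd * q ^ (2 * i)\<close> in the tail weight. For \<open>t = 0\<close> the truncated
  subtraction gives 0.\<close>

lemma X_multiple_indet_weight: "X_multiple ((t - 1) div 8) (indet_weight t i j)"
proof (cases t)
  case 0
  have "is_fps ((indet_a * indet_q ^ j + inverse indet_a * inverse (indet_q ^ j)) * inverse 2)"
    by (intro is_fps_intros is_fps_inverse_power)
  thus ?thesis by (simp only: 0 aw_weight_def divide_inverse simp_thms if_True diff_0_eq_0 div_0)
next
  case (Suc t')
  define xs where "xs = [- (inverse indet_a * inverse (indet_q ^ i)), indet_d, indet_c,
      - (indet_a * indet_c * indet_d * indet_q ^ i), indet_b, - (indet_a * indet_b * indet_d * indet_q ^ i),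
      - (indet_a * indet_b * indet_c * indet_q ^ i),
      indet_a\<^sup>2 * indet_b * indet_c * indet_d * indet_q ^ (2 * i)]"
  have "list_all is_fps xs"
    unfolding xs_def list.pred_inject by (intro conjI list.pred_inject(1) is_fps_intros is_fps_inverse_power)
  moreover have "t' mod 8 < length xs" by (simp add: xs_def)
  ultimately have "is_fps (xs ! (t' mod 8))" by (simp add: list_all_length)
  moreover have "is_fps (1 / 2 :: aw_field)" using is_fps_indet(7) by (simp only: inverse_eq_divide)
  moreover have "is_fps (indet_q ^ j)" by (intro is_fps_intros)
  ultimately have "X_multiple (t' div 8) (1 / 2 *
      (indet_a * indet_b * indet_c * indet_d * indet_q ^ (2 * i)) ^ (t' div 8) * indet_q ^ j * xs ! (t' mod 8))"
    by (intro X_multiple_mult_right[OF X_multiple_mult_right] X_multiple_mult_left X_multiple_ypow)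
  thus ?thesis
    by (simp only: Suc aw_weight_def aw_weight_tail_def xs_def nat.distinct if_False diff_Suc_1)
qed

section \<open>The formal sum over all paths\<close>

definition fps_weight :: "nat \<Rightarrow> nat \<Rightarrow> nat \<Rightarrow> laurent pow3" where
  "fps_weight t i j = (SOME r. indet_weight t i j = to_fract r)"

lemma to_fract_fps_weight: "to_fract (fps_weight t i j) = indet_weight t i j"
proof -
  have "\<exists>r. indet_weight t i j = to_fract r"
    using X_multiple_indet_weight[of t i j] by (auto simp: X_multiple_def simp del: to_fract_mult)
  from someI_ex[OF this] show ?thesis by (simp add: fps_weight_def)
qed

lemma to_fract_path_weight: "to_fract (path_weight fps_weight p) = path_weight indet_weight p"
  unfolding path_weight_def to_fract_prod by (intro prod.cong) (auto simp: to_fract_fps_weight)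

lemma to_fract_key_sum: "to_fract (key_sum fps_weight N n \<kappa> k) = key_sum indet_weight N n \<kappa> k"
  by (simp add: key_sum_def key_weight_def to_fract_prod to_fract_fps_weight)

text \<open>Some key lies in a layer \<open>t \<ge> 8 * (l + 1) + 1\<close>, whose weights are
  divisible by \<open>d ^ (l + 1)\<close>.\<close>

lemma key_weight_nth_0:
  assumes "s \<in> key_seqs N k n" and "s \<notin> key_seqs_below N k n ((8 * l + 9) * N)" and "0 < N"
  shows "fps_nth (key_weight fps_weight N k n s) l = 0"
proof -
  obtain i where i: "i \<in> {k..<n}" "(8 * l + 9) * N \<le> s i"
    using assms(1,2) by (auto simp: key_seqs_below_def not_less)
  have "8 * l + 9 \<le> s i div N" using i(2) assms(3) by (simp add: less_eq_div_iff_mult_less_eq)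
  hence "l < (s i div N - 1) div 8" by linarith
  hence "X_multiple (Suc l) (indet_weight (s i div N) i (s i mod N))"
    using X_multiple_mono[OF X_multiple_indet_weight] by (metis Suc_leI)
  hence "X_multiple (Suc l) (\<Prod>i=k..<n. indet_weight (s i div N) i (s i mod N))"
    using i(1) X_multiple_is_fps[OF X_multiple_indet_weight] by (intro X_multiple_prod[of _ _ i]) auto
  hence "X_multiple (Suc l) (to_fract (key_weight fps_weight N k n s))"
    by (simp add: key_weight_def to_fract_prod to_fract_fps_weight)
  thus ?thesis by (simp add: X_multiple_to_fract_iff)
qed

lemma key_sum_nth_stable:
  assumes "0 < N" and "(8 * l + 9) * N \<le> \<kappa>"
  shows "fps_nth (key_sum fps_weight N n \<kappa> k) l = fps_nth (key_sum fps_weight N n ((8 * l + 9) * N) k) l"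
  unfolding key_sum_def fps_sum_nth using key_weight_nth_0[OF _ _ assms(1), of _ k n l] assms(2)
  by (intro sum.mono_neutral_right finite_key_seqs_below) (fastforce simp: key_seqs_below_def)+

text \<open>The d-adic limit of the truncated sums: each coefficient is read off at a bound beyond
  which it is stable.\<close>

definition path_series :: "nat \<Rightarrow> nat \<Rightarrow> laurent pow3" where
  "path_series n k = Abs_fps (\<lambda>l. fps_nth (key_sum fps_weight (Suc n) n ((8 * l + 9) * Suc n) k) l)"

lemma has_formal_sum_path_series:
  assumes "k \<le> n"
  shows "has_formal_sum (path_weight indet_weight) (SE_paths k n) (to_fract (path_series n k))"
  unfolding has_formal_sum_def
proof (intro exI[of _ "path_weight fps_weight"] exI[of _ "path_series n k"] conjI allI ballI refl)
  show "path_weight indet_weight p = to_fract (path_weight fps_weight p)" for p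
    by (simp add: to_fract_path_weight)
next
  fix i j l
  \<comment> \<open>Only these finitely many sequences contribute to a monomial with
    \<open>d ^ l\<close>, whatever the exponents of \<open>b\<close> and \<open>c\<close>.\<close>
  define B where "B = key_seqs_below (Suc n) k n ((8 * l + 9) * Suc n)"
  let ?wp = "walk_path (Suc n) k n"
  let ?nz = "{p \<in> SE_paths k n. coeff3 (path_weight fps_weight p) i j l \<noteq> 0}"
  have SE: "SE_paths k n = ?wp ` key_seqs (Suc n) k n" and inj: "inj_on ?wp (key_seqs (Suc n) k n)"
    using bij_betw_walk_path[OF assms lessI] by (auto simp: bij_betw_def)
  have pw: "path_weight fps_weight (?wp s) = key_weight fps_weight (Suc n) k n s"
    if "s \<in> key_seqs (Suc n) k n" for s
    using path_weight_walk_path[OF assms lessI that] by (simp add: key_weight_def)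
  have B_sub: "B \<subseteq> key_seqs (Suc n) k n" by (auto simp: B_def key_seqs_below_def)
  have sub: "?nz \<subseteq> ?wp ` B"
  proof
    fix p assume p: "p \<in> ?nz"
    then obtain s where s: "s \<in> key_seqs (Suc n) k n" "p = ?wp s" by (auto simp: SE)
    have "s \<in> B"
    proof (rule ccontr)
      assume "s \<notin> B"
      hence "coeff3 (path_weight fps_weight p) i j l = 0"
        using key_weight_nth_0[of s "Suc n" k n l] s by (simp add: pw coeff3_def B_def)
      thus False using p by simp
    qed
    thus "p \<in> ?wp ` B" using s by blast
  qed
  have fin: "finite (?wp ` B)" by (simp add: B_def finite_key_seqs_below)
  show "finite ?nz" by (rule finite_subset[OF sub fin])
  have "coeff3 (path_series n k) i j l = (\<Sum>s\<in>B. coeff3 (key_weight fps_weight (Suc n) k n s) i j l)"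
    by (simp add: path_series_def coeff3_def key_sum_def fps_sum_nth B_def)
  also have "\<dots> = (\<Sum>s\<in>B. coeff3 (path_weight fps_weight (?wp s)) i j l)"
    using B_sub by (intro sum.cong refl) (auto simp: pw)
  also have "\<dots> = (\<Sum>p\<in>?wp ` B. coeff3 (path_weight fps_weight p) i j l)"
    by (simp add: sum.reindex inj_on_subset[OF inj B_sub])
  also have "\<dots> = (\<Sum>p\<in>?nz. coeff3 (path_weight fps_weight p) i j l)"
    using fin sub B_sub by (intro sum.mono_neutral_right) (auto simp: SE)
  finally show "coeff3 (path_series n k) i j l = (\<Sum>p\<in>?nz. coeff3 (path_weight fps_weight p) i j l)" .
qed

section \<open>Comparison of the path sum with the mixed moment\<close>

lemma path_series_minus_trunc_sum:
  assumes "k \<le> n"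
  shows "X_multiple M (to_fract (path_series n k) - trunc_sum indet_weight (8 * M + 1) n k)"
proof -
  have "fps_nth (path_series n k) l = fps_nth (key_sum fps_weight (Suc n) n ((8 * M + 1) * Suc n) k) l" if "l < M" for l
  proof -
    have "(8 * l + 9) * Suc n \<le> (8 * M + 1) * Suc n" using that by (intro mult_le_mono1) simp
    thus ?thesis using key_sum_nth_stable[of "Suc n" l "(8 * M + 1) * Suc n" n k]
      by (simp add: path_series_def)
  qed
  hence "X_multiple M (to_fract (path_series n k - key_sum fps_weight (Suc n) n ((8 * M + 1) * Suc n) k))"
    unfolding X_multiple_to_fract_iff fps_sub_nth by simp
  thus ?thesis using assms by (simp only: to_fract_diff to_fract_key_sum trunc_sum_def if_True)
qed

text \<open>The first factor is a common multiple of the denominators of \<open>aw_conn\<close> in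
  all rows \<open>m \<le> n\<close>. It allows divisibility to be stated without inverting power
  series.\<close>

lemma X_multiple_conn:
  assumes "k < m" "m \<le> n"
  shows "X_multiple M (qpoch (indet_a * indet_b * indet_c * indet_d * indet_q ^ (2 * k)) indet_q (n - k) *
    mat_scale (indet.ypow M) indet.aw_conn m k)"
proof -
  define y where "y = indet_a * indet_b * indet_c * indet_d * indet_q ^ (2 * k)"
  have "is_fps (1 - y * indet_q ^ i)" for i
    unfolding y_def by (intro is_fps_intros)
  hence poch: "is_fps (qpoch (y * indet_q ^ i) indet_q l)" for i l
    unfolding qpoch_def mult.assoc power_add[symmetric] by (intro is_fps_prod)
  have "qpoch y indet_q (n - k) = qpoch y indet_q (m - k) * qpoch (y * indet_q ^ (m - k)) indet_q (n - m)"
    using qpoch_add[of y indet_q "m - k" "n - m"] assms by simp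
  moreover have "qpoch y indet_q (m - k) \<noteq> 0" unfolding y_def by simp
  ultimately have eq: "qpoch y indet_q (n - k) * mat_scale (indet.ypow M) indet.aw_conn m k =
      qpoch (y * indet_q ^ (m - k)) indet_q (n - m) * (qbin indet_q m k *
        (\<Prod>i=k..<m. indet.\<omega> i * indet.\<rho> i)) * (\<Prod>i=k..<m. indet.ypow M i)"
    by (simp add: mat_scale_def indet.conn_def y_def)
  have "is_fps (indet.\<omega> i)" "is_fps (indet.\<rho> i)" for i
    unfolding indet.\<omega>_def indet.\<rho>_def
    by (simp_all only: inverse_mult_distrib power_inverse[symmetric]) (intro is_fps_intros)+
  \<comment> \<open>As a complete homogeneous polynomial the Gaussian binomial is visibly a power
    series.\<close>
  moreover have "is_fps (qbin indet_q m k)"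
    using indet.hsym_power[of k "m - k"] assms is_fps_hsym[of "\<lambda>j. indet_q ^ j" "Suc k" "m - k"]
    by (simp add: is_fps_intros del: hsym.simps)
  \<comment> \<open>Since \<open>k < m\<close> the product is not empty, and its factor at
    \<open>i = k\<close> already supplies \<open>d ^ M\<close>.\<close>
  moreover have "X_multiple M (\<Prod>i=k..<m. indet.ypow M i)"
    using assms X_multiple_ypow X_multiple_is_fps[OF X_multiple_ypow]
    by (intro X_multiple_prod[of _ _ k]) auto
  ultimately show ?thesis
    unfolding y_def[symmetric] eq using poch by (intro X_multiple_mult_left is_fps_prod)
qed

lemma aw_mixed_moment_eq_path_series:
  assumes "k \<le> n"
  shows "aw_mixed_moment indet_a indet_b indet_c indet_d indet_q n k = to_fract (path_series n k)"
    (is "?\<sigma> = _")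
proof -
  define D where "D = qpoch (indet_a * indet_b * indet_c * indet_d * indet_q ^ (2 * k)) indet_q (n - k)"
  have D: "D \<noteq> 0" by (simp add: D_def)
  have D_fps: "is_fps D" unfolding D_def qpoch_def by (intro is_fps_intros)
  \<comment> \<open>Moment and series are both compared with the truncated sum after
    \<open>M\<close> periods; the factor \<open>D\<close> clears the denominators of the
    remainder.\<close>
  have "X_multiple M (D * (?\<sigma> - to_fract (path_series n k)))" for M
  proof -
    let ?S = "trunc_sum indet_weight (8 * M + 1) n"
    have "is_fps (?S m)" for m
    proof -
      have "?S m = (if m \<le> n then to_fract (key_sum fps_weight (Suc n) n ((8 * M + 1) * Suc n) m) else 0)"
        by (simp only: trunc_sum_def to_fract_key_sum)
      thus ?thesis by simp
    qed
    moreover have "D * (?\<sigma> - ?S k) = (\<Sum>m=Suc k..n. ?S m * (D * mat_scale (indet.ypow M) indet.aw_conn m k))"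
      unfolding indet.aw_mixed_moment_minus_trunc_sum[OF assms] by (simp add: sum_distrib_left mult_ac)
    moreover have "X_multiple M (D * mat_scale (indet.ypow M) indet.aw_conn m k)" if "m \<in> {Suc k..n}" for m
      using X_multiple_conn[of k m n M] that by (simp add: D_def)
    ultimately have "X_multiple M (D * (?\<sigma> - ?S k))"
      by (simp only:) (rule X_multiple_sum, rule X_multiple_mult_left)
    moreover have "X_multiple M (D * (to_fract (path_series n k) - ?S k))"
      using D_fps path_series_minus_trunc_sum[OF assms] by (rule X_multiple_mult_left)
    ultimately have "X_multiple M (D * (?\<sigma> - ?S k) - D * (to_fract (path_series n k) - ?S k))"
      by (rule X_multiple_diff)
    thus ?thesis by (simp add: algebra_simps)
  qed
  \<comment> \<open>Divisible by every power of \<open>d\<close>, the product vanishes; as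
    \<open>D\<close> is nonzero, so does the difference.\<close>
  hence "D * (?\<sigma> - to_fract (path_series n k)) = 0" by (rule X_multiple_all_imp_0)
  thus ?thesis using D by simp
qed

theorem theorem4p24:
  fixes n k :: nat
  assumes "k \<le> n"
  shows "formally_summable
      (path_weight (aw_weight indet_a indet_b indet_c indet_d indet_q)) (SE_paths k n) \<and>
    aw_mixed_moment indet_a indet_b indet_c indet_d indet_q n k =
      lh_h (aw_weight indet_a indet_b indet_c indet_d indet_q) n k"
  using has_formal_sum_path_series[OF assms] aw_mixed_moment_eq_path_series[OF assms]
  unfolding formally_summable_def lh_h_def by (auto simp: formal_sum_eqI)

end
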